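(* Let $\mathcal{L}$ be an operator on $\mathbb{R}^n$ satisfying the standing assumptions listed in the context. Let $0<p<1$ and let $u\ge 0$, with $u^p\in L^1(\mathbb{R}^n,\mathbb{R})$, be a smooth solution to $\mathcal{L}u=0$ in $\mathbb{R}^n$. Then $u\equiv 0$.
   Context: Standing assumptions. $\mathcal{L}:=\mathrm{div}(A\nabla)+\langle b,\nabla\rangle$ is a linear second order partial differential operator on $\mathbb{R}^n$, where $A=(a_{ij})_{i,j=1,\dots,n}$ is a symmetric $n\times n$ matrix with entries $a_{ij}\in C^\infty(\mathbb{R}^n,\mathbb{R})$, $b=(b_1,\dots,b_n)$ has components $b_j\in C^\infty(\mathbb{R}^n,\mathbb{R})$, and $\mathrm{div}$, $\nabla$, $\langle\cdot,\cdot\rangle$ are the Euclidean divergence, gradient and inner product. It is assumed that $\langle A(x)\xi,\xi\rangle\ge 0$ for all $x,\xi\in\mathbb{R}^n$ and $\mathrm{trace}\,A(0)>0$. Moreover: (1) $\mathcal{L}$ is hypoelliptic: if $w$ is a distribution on an open set $\Omega\subseteq\mathbb{R}^n$ and $\mathcal{L}w$ is smooth in $\Omega$, then $w$ is smooth in $\Omega$. (2) There is a Lie group $\mathbb{G}=(\mathbb{R}^n,\circ)$ such that $\mathcal{L}$ is left translation invariant on $\mathbb{G}$, i.e. $\mathcal{L}(w(\alpha\circ\cdot))(x)=(\mathcal{L}w)(\alpha\circ x)$ for all $\alpha,x\in\mathbb{R}^n$ and all $w\in C^\infty(\mathbb{R}^n,\mathbb{R})$. (3) The Lebesgue measure on $\mathbb{R}^n$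 is both left and right invariant on $\mathbb{G}$. $L^1$ is taken with respect to Lebesgue measure. *)

theory Defs
  imports "HOL-Analysis.Analysis"
begin

section \<open>Smooth functions\<close>

definition partial_derivative ::
    "'a::real_normed_vector \<Rightarrow> ('a \<Rightarrow> 'b::real_normed_vector) \<Rightarrow> 'a \<Rightarrow> 'b" where
  "partial_derivative v f x = frechet_derivative f (at x) v"

text \<open>Of interest for open \<open>S\<close> only: derivatives are taken in the whole space.\<close>

primrec Ck_on ::
    "nat \<Rightarrow> ('a::euclidean_space \<Rightarrow> 'b::real_normed_vector) \<Rightarrow> 'a set \<Rightarrow> bool" where
  "Ck_on 0 f S \<longleftrightarrow> continuous_on S f"
| "Ck_on (Suc k) f S \<longleftrightarrow>
     (\<forall>x\<in>S. f differentiable (at x)) \<and> (\<forall>v\<in>Basis. Ck_on k (partial_derivative v f) S)"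

definition smooth_on ::
    "('a::euclidean_space \<Rightarrow> 'b::real_normed_vector) \<Rightarrow> 'a set \<Rightarrow> bool" where
  "smooth_on f S \<longleftrightarrow> (\<forall>k. Ck_on k f S)"

section \<open>The operator\<close>

definition gradient :: "(real^'n \<Rightarrow> real) \<Rightarrow> real^'n \<Rightarrow> real^'n" where
  "gradient f x = (\<chi> i. partial_derivative (axis i 1) f x)"

definition divergence :: "(real^'n \<Rightarrow> real^'n) \<Rightarrow> real^'n \<Rightarrow> real" where
  "divergence F x = (\<Sum>i\<in>UNIV. partial_derivative (axis i 1) (\<lambda>y. F y $ i) x)"

definition diff_op ::
    "(real^'n \<Rightarrow> real^'n^'n) \<Rightarrow> (real^'n \<Rightarrow> real^'n) \<Rightarrow> (real^'n \<Rightarrow> real) \<Rightarrow> real^'n \<Rightarrow> real" where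
  "diff_op A b f x = divergence (\<lambda>y. A y *v gradient f y) x + b x \<bullet> gradient f x"

section \<open>Distributions\<close>

text \<open>Distributions are real-valued functionals, represented by total functions on
  \<open>real^'n \<Rightarrow> real\<close>; only their values on test functions matter.\<close>

definition test_functions :: "(real^'n) set \<Rightarrow> (real^'n \<Rightarrow> real) set" where
  "test_functions \<Omega> = {\<phi>. smooth_on \<phi> UNIV \<and>
     compact (closure {x. \<phi> x \<noteq> 0}) \<and> closure {x. \<phi> x \<noteq> 0} \<subseteq> \<Omega>}"

text \<open>Continuity is expressed by the usual seminorm estimates on compact sets. Iterated partial
  derivatives are indexed by lists of coordinate directions instead of multi-indices; as mixed
  derivatives of smooth functions commute, this only repeats summands.\<close>

definition distribution_on ::
    "(real^'n) set \<Rightarrow> ((real^'n \<Rightarrow> real) \<Rightarrow> real) \<Rightarrow> bool" where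
  "distribution_on \<Omega> T \<longleftrightarrow>
     (\<forall>\<phi>\<in>test_functions \<Omega>. \<forall>\<psi>\<in>test_functions \<Omega>. T (\<lambda>x. \<phi> x + \<psi> x) = T \<phi> + T \<psi>) \<and>
     (\<forall>c. \<forall>\<phi>\<in>test_functions \<Omega>. T (\<lambda>x. c * \<phi> x) = c * T \<phi>) \<and>
     (\<forall>K. compact K \<and> K \<subseteq> \<Omega> \<longrightarrow>
       (\<exists>C m. \<forall>\<phi>\<in>test_functions K.
          \<bar>T \<phi>\<bar> \<le> C * (\<Sum>vs\<in>{vs. set vs \<subseteq> Basis \<and> length vs \<le> m}.
                           SUP x. \<bar>foldr partial_derivative vs \<phi> x\<bar>)))"

definition dist_partial ::
    "real^'n \<Rightarrow> ((real^'n \<Rightarrow> real) \<Rightarrow> real) \<Rightarrow> (real^'n \<Rightarrow> real) \<Rightarrow> real" where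
  "dist_partial v T \<phi> = - T (partial_derivative v \<phi>)"

definition dist_mult ::
    "(real^'n \<Rightarrow> real) \<Rightarrow> ((real^'n \<Rightarrow> real) \<Rightarrow> real) \<Rightarrow> (real^'n \<Rightarrow> real) \<Rightarrow> real" where
  "dist_mult a T \<phi> = T (\<lambda>x. a x * \<phi> x)"

definition dist_diff_op ::
    "(real^'n \<Rightarrow> real^'n^'n) \<Rightarrow> (real^'n \<Rightarrow> real^'n) \<Rightarrow>
     ((real^'n \<Rightarrow> real) \<Rightarrow> real) \<Rightarrow> (real^'n \<Rightarrow> real) \<Rightarrow> real" where
  "dist_diff_op A b T \<phi> =
     (\<Sum>i\<in>UNIV. dist_partial (axis i 1)
        (\<lambda>\<psi>. \<Sum>j\<in>UNIV. dist_mult (\<lambda>x. A x $ i $ j) (dist_partial (axis j 1) T) \<psi>) \<phi>) +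
     (\<Sum>i\<in>UNIV. dist_mult (\<lambda>x. b x $ i) (dist_partial (axis i 1) T) \<phi>)"

definition smooth_distribution_on ::
    "(real^'n) set \<Rightarrow> ((real^'n \<Rightarrow> real) \<Rightarrow> real) \<Rightarrow> bool" where
  "smooth_distribution_on \<Omega> T \<longleftrightarrow>
     (\<exists>f. smooth_on f \<Omega> \<and>
       (\<forall>\<phi>\<in>test_functions \<Omega>. T \<phi> = integral\<^sup>L lebesgue (\<lambda>x. f x * \<phi> x)))"

definition hypoelliptic ::
    "(real^'n \<Rightarrow> real^'n^'n) \<Rightarrow> (real^'n \<Rightarrow> real^'n) \<Rightarrow> bool" where
  "hypoelliptic A b \<longleftrightarrow>
     (\<forall>\<Omega> T. open \<Omega> \<and> distribution_on \<Omega> T \<and> smooth_distribution_on \<Omega> (dist_diff_op A b T)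
        \<longrightarrow> smooth_distribution_on \<Omega> T)"

section \<open>Lie groups on Euclidean space\<close>

definition lie_group ::
    "('a \<Rightarrow> 'a \<Rightarrow> 'a) \<Rightarrow> 'a \<Rightarrow> ('a \<Rightarrow> 'a::euclidean_space) \<Rightarrow> bool" where
  "lie_group mul e iv \<longleftrightarrow>
     group mul e iv \<and> smooth_on (\<lambda>(x, y). mul x y) UNIV \<and> smooth_on iv UNIV"

definition left_translation_invariant ::
    "(real^'n \<Rightarrow> real^'n \<Rightarrow> real^'n) \<Rightarrow> ((real^'n \<Rightarrow> real) \<Rightarrow> real^'n \<Rightarrow> real) \<Rightarrow> bool" where
  "left_translation_invariant mul L \<longleftrightarrow>
     (\<forall>\<alpha> x w. smooth_on w UNIV \<longrightarrow> L (\<lambda>y. w (mul \<alpha> y)) x = L w (mul \<alpha> x))"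

definition lebesgue_left_invariant :: "('a \<Rightarrow> 'a \<Rightarrow> 'a::euclidean_space) \<Rightarrow> bool" where
  "lebesgue_left_invariant mul \<longleftrightarrow>
     (\<forall>\<alpha>. \<forall>E\<in>sets lebesgue. emeasure lebesgue ((\<lambda>x. mul \<alpha> x) ` E) = emeasure lebesgue E)"

definition lebesgue_right_invariant :: "('a \<Rightarrow> 'a \<Rightarrow> 'a::euclidean_space) \<Rightarrow> bool" where
  "lebesgue_right_invariant mul \<longleftrightarrow>
     (\<forall>\<alpha>. \<forall>E\<in>sets lebesgue. emeasure lebesgue ((\<lambda>x. mul x \<alpha>) ` E) = emeasure lebesgue E)"

end

theory Submission
  imports Defs
begin

text \<open>
  The function \<open>f = 1 - exp (- u)\<close> is a bounded concave image of \<open>u\<close> with \<open>0 \<le> f \<le> u\<^sup>p\<close>, so it is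
  integrable and \<open>\<L> f = - exp (- u) \<langle>A \<nabla>u, \<nabla>u\<rangle> \<le> 0\<close>. Pair the left translates \<open>f (z \<circ> \<cdot>)\<close> with a bump
  function \<open>\<eta>\<close> and integrate over all \<open>z\<close>: by Fubini and right invariance,
  \<open>(\<integral>\<eta>) (\<integral>\<L> f) = (\<integral>f) (\<integral>\<L>* \<eta>) = 0\<close>, because \<open>\<integral>\<L>* \<eta> = \<integral>\<eta> \<L> 1 = 0\<close>. Hence \<open>\<langle>A \<nabla>u, \<nabla>u\<rangle> = 0\<close>
  everywhere, and \<open>\<L> (h (u)) = 0\<close> for every smooth \<open>h\<close>. As the limit
  of \<open>(u - c) tanh (k (u - c))\<close> for \<open>k \<rightarrow> \<infinity>\<close>, \<open>\<bar>u - c\<bar>\<close> is a distributional solution for every constant \<open>c\<close>, hence smooth by hypoellipticity;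
  taking \<open>c = u x\<close> this forces the gradient of \<open>u\<close> to vanish at \<open>x\<close>. So \<open>u\<close> is constant, and the only
  constant with integrable \<open>p\<close>-th power is \<open>0\<close>.
\<close>

section \<open>Calculus of \<open>C\<^sup>k\<close> functions\<close>

lemma partial_derivative_eq:
  assumes "(f has_derivative f') (at x)"
  shows "partial_derivative v f x = f' v"
  using frechet_derivative_at[OF assms] by (simp add: partial_derivative_def)

text \<open>\<open>Ck_on (Suc k)\<close> does not list continuity of the function itself; in the
  base case it comes from differentiability.\<close>

lemma Ck_on_SucD:
  "Ck_on (Suc k) f S \<Longrightarrow> Ck_on k f S"
proof (induction k arbitrary: f)
  case 0
  then show ?case
    by (auto intro!: continuous_at_imp_continuous_on differentiable_imp_continuous_within)
qed auto

lemma Ck_on_le: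
  assumes "Ck_on k f S" "l \<le> k"
  shows "Ck_on l f S"
  using assms(2,1) by (induction rule: dec_induct) (auto intro: Ck_on_SucD simp del: Ck_on.simps)

lemma smooth_imp_Ck: "smooth_on f S \<Longrightarrow> Ck_on k f S"
  by (simp add: smooth_on_def)

lemma Ck_has_derivative:
  assumes "Ck_on k f UNIV" "0 < k"
  shows "(f has_derivative (\<lambda>v. partial_derivative v f x)) (at x)"
proof -
  have "Ck_on (Suc 0) f UNIV"
    using assms Ck_on_le by (metis Suc_leI)
  then show ?thesis
    by (simp add: partial_derivative_def frechet_derivative_works)
qed

lemma Ck_partial:
  "Ck_on (Suc k) f S \<Longrightarrow> v \<in> Basis \<Longrightarrow> Ck_on k (partial_derivative v f) S"
  by simp

lemma Ck_continuous: "Ck_on k f S \<Longrightarrow> continuous_on S f"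
  using Ck_on_le[of k f S 0] by simp

text \<open>Trades \<open>frechet_derivative\<close> for an explicit derivative formula, so that
  closure properties follow by induction on \<open>k\<close> from the usual differentiation
  rules.\<close>

lemma Ck_SucI:
  assumes "\<And>x. (f has_derivative f' x) (at x)"
    and "\<And>v. v \<in> Basis \<Longrightarrow> Ck_on k (\<lambda>x. f' x v) UNIV"
  shows "Ck_on (Suc k) f UNIV"
proof -
  have "partial_derivative v f = (\<lambda>x. f' x v)" for v
    using partial_derivative_eq[OF assms(1)] by auto
  then show ?thesis
    using assms by (auto simp: differentiable_def)
qed

lemma Ck_const: "Ck_on k (\<lambda>x. c) UNIV"
proof (induction k arbitrary: c)
  case (Suc k)
  show ?case
    by (rule Ck_SucI[where f' = "\<lambda>_ _. 0"]) (use Suc in auto)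
qed simp

lemma Ck_linear:
  assumes "bounded_linear f"
  shows "Ck_on k f UNIV"
proof (cases k)
  case 0
  then show ?thesis
    using assms by (auto intro: linear_continuous_on)
next
  case (Suc l)
  show ?thesis
    unfolding Suc
    by (rule Ck_SucI[where f' = "\<lambda>_. f"]) (auto intro: Ck_const bounded_linear_imp_has_derivative assms)
qed

lemma Ck_bounded_linear_comp:
  assumes "bounded_linear h" "Ck_on k f UNIV"
  shows "Ck_on k (\<lambda>x. h (f x)) UNIV"
  using assms(2)
proof (induction k arbitrary: f)
  case 0
  then show ?case
    using assms(1) by (auto intro: bounded_linear.continuous_on)
next
  case (Suc k)
  show ?case
  proof (rule Ck_SucI)
    show "((\<lambda>x. h (f x)) has_derivative (\<lambda>v. h (partial_derivative v f x))) (at x)" for x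
      by (rule bounded_linear.has_derivative[OF assms(1) Ck_has_derivative[OF Suc.prems]]) simp
  qed (use Suc in auto)
qed

lemma Ck_add:
  assumes "Ck_on k f UNIV" "Ck_on k g UNIV"
  shows "Ck_on k (\<lambda>x. f x + g x) UNIV"
  using assms
proof (induction k arbitrary: f g)
  case 0
  then show ?case by (auto intro: continuous_on_add)
next
  case (Suc k)
  show ?case
    by (rule Ck_SucI, rule has_derivative_add, (rule Ck_has_derivative, use Suc.prems in blast, simp)+)
      (use Suc in auto)
qed

lemma Ck_sum:
  assumes "\<And>i. i \<in> I \<Longrightarrow> Ck_on k (f i) UNIV"
  shows "Ck_on k (\<lambda>x. \<Sum>i\<in>I. f i x) UNIV"
  using assms by (induction I rule: infinite_finite_induct) (auto intro: Ck_const Ck_add)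

lemma Ck_mult:
  fixes f g :: "'a::euclidean_space \<Rightarrow> real"
  assumes "Ck_on k f UNIV" "Ck_on k g UNIV"
  shows "Ck_on k (\<lambda>x. f x * g x) UNIV"
  using assms
proof (induction k arbitrary: f g)
  case 0
  then show ?case by (auto intro: continuous_on_mult)
next
  case (Suc k)
  show ?case
  proof (rule Ck_SucI)
    show "((\<lambda>x. f x * g x) has_derivative
        (\<lambda>v. f x * partial_derivative v g x + partial_derivative v f x * g x)) (at x)" for x
      by (rule has_derivative_mult Ck_has_derivative Suc.prems zero_less_Suc)+
  next
    fix v :: 'a
    assume v: "v \<in> Basis"
    show "Ck_on k (\<lambda>x. f x * partial_derivative v g x + partial_derivative v f x * g x) UNIV"
      by (intro Ck_add Suc.IH Ck_partial v Suc.prems Ck_on_SucD[OF Suc.prems(1)]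
          Ck_on_SucD[OF Suc.prems(2)])
  qed
qed

lemma Ck_minus:
  "Ck_on k f UNIV \<Longrightarrow> Ck_on k (\<lambda>x. - f x) UNIV"
  by (rule Ck_bounded_linear_comp[OF bounded_linear_minus[OF bounded_linear_ident]])

lemma Ck_diff:
  "Ck_on k f UNIV \<Longrightarrow> Ck_on k g UNIV \<Longrightarrow> Ck_on k (\<lambda>x. f x - g x) UNIV"
  using Ck_add[OF _ Ck_minus, of k f g] by simp

text \<open>The derivative of \<open>f\<close>, being linear, is expanded over the basis of its
  domain. The chain rule then gives a finite sum of products, which the induction hypothesis and
  \<open>Ck_mult\<close> handle.\<close>

lemma Ck_compose:
  fixes f :: "'b::euclidean_space \<Rightarrow> real" and G :: "'a::euclidean_space \<Rightarrow> 'b"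
  assumes "Ck_on k f UNIV" "Ck_on k G UNIV"
  shows "Ck_on k (\<lambda>x. f (G x)) UNIV"
  using assms
proof (induction k arbitrary: f)
  case 0
  then show ?case by (auto intro: continuous_on_compose2)
next
  case (Suc k)
  have G: "Ck_on k G UNIV"
    using Suc.prems(2) by (rule Ck_on_SucD)
  show ?case
  proof (rule Ck_SucI)
    fix x
    have lin: "linear (\<lambda>v. partial_derivative v f (G x))"
      using has_derivative_linear[OF Ck_has_derivative[OF Suc.prems(1)]] by simp
    have "((\<lambda>x. f (G x)) has_derivative
        (\<lambda>v. partial_derivative (partial_derivative v G x) f (G x))) (at x)"
      using has_derivative_compose[OF Ck_has_derivative[OF Suc.prems(2)] Ck_has_derivative[OF Suc.prems(1)]]
      by simp
    moreover have "partial_derivative w f (G x) = (\<Sum>j\<in>Basis. partial_derivative j f (G x) * (w \<bullet> j))" for w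
      using Linear_Algebra.linear_componentwise[OF lin, of w 1] by (simp add: mult.commute)
    ultimately show "((\<lambda>x. f (G x)) has_derivative
        (\<lambda>v. \<Sum>j\<in>Basis. partial_derivative j f (G x) * (partial_derivative v G x \<bullet> j))) (at x)"
      by (rule has_derivative_eq_rhs[OF _ ext])
  next
    fix v :: 'a
    assume v: "v \<in> Basis"
    show "Ck_on k (\<lambda>x. \<Sum>j\<in>Basis. partial_derivative j f (G x) * (partial_derivative v G x \<bullet> j)) UNIV"
    proof (intro Ck_sum Ck_mult)
      fix j :: 'b
      assume "j \<in> Basis"
      then show "Ck_on k (\<lambda>x. partial_derivative j f (G x)) UNIV"
        by (rule Suc.IH[OF Ck_partial[OF Suc.prems(1)] G])
      show "Ck_on k (\<lambda>x. partial_derivative v G x \<bullet> j) UNIV"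
        by (rule Ck_bounded_linear_comp[OF bounded_linear_inner_left Ck_partial[OF Suc.prems(2) v]])
    qed
  qed
qed

section \<open>Integration by parts\<close>

text \<open>The complement of \<open>K\<close> is open, so \<open>f\<close> vanishes near
  \<open>x\<close>.\<close>

lemma partial_derivative_eq_0_outside:
  assumes "\<And>x. x \<notin> K \<Longrightarrow> f x = 0" "closed K" "x \<notin> K"
  shows "partial_derivative v f x = 0"
proof -
  have "(f has_derivative (\<lambda>_. 0)) (at x)"
    by (rule has_derivative_transform_within_open[OF has_derivative_const[of 0], of "- K"])
       (use assms in auto)
  then show ?thesis
    by (simp add: partial_derivative_eq)
qed

lemma integrable_continuous_compact_support:
  fixes f :: "'a::euclidean_space \<Rightarrow> real"
  assumes "continuous_on UNIV f" "compact K" "\<And>x. x \<notin> K \<Longrightarrow> f x = 0"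
  shows "integrable lborel f"
proof -
  have "integrable lborel (\<lambda>x. indicator K x *\<^sub>R f x)"
    using assms by (intro borel_integrable_compact continuous_on_subset[OF assms(1)]) auto
  also have "(\<lambda>x. indicator K x *\<^sub>R f x) = f"
    using assms(3) by (fastforce simp: indicator_def)
  finally show ?thesis .
qed

lemma integral_translation:
  fixes f :: "'a::euclidean_space \<Rightarrow> real"
  assumes "f \<in> borel_measurable borel"
  shows "(\<integral>x. f (x + v) \<partial>lborel) = (\<integral>x. f x \<partial>lborel)"
proof -
  have "(\<integral>x. f x \<partial>lborel) = (\<integral>x. f x \<partial>distr lborel borel ((+) v))"
    using lborel_distr_plus[of v] by simp
  also have "\<dots> = (\<integral>x. f (v + x) \<partial>lborel)"
    using assms by (intro integral_distr) auto
  finally show ?thesis by (simp add: add.commute)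
qed

text \<open>By translation invariance all difference quotients of \<open>\<psi>\<close> in direction
  \<open>v\<close> have integral 0; dominated convergence carries this over to the
  derivative.\<close>

lemma integral_partial_derivative_eq_0:
  fixes \<psi> :: "'a::euclidean_space \<Rightarrow> real"
  assumes C1: "Ck_on 1 \<psi> UNIV" and v: "v \<in> Basis"
    and K: "compact K" "\<And>x. x \<notin> K \<Longrightarrow> \<psi> x = 0"
  shows "(\<integral>x. partial_derivative v \<psi> x \<partial>lborel) = 0"
proof -
  let ?D = "partial_derivative v \<psi>"
  have cont: "continuous_on UNIV ?D" "continuous_on UNIV \<psi>"
    using Ck_partial[of 0 \<psi> UNIV v] Ck_continuous[OF C1] C1 v by auto
  have D0: "?D x = 0" if "x \<notin> K" for x
    using partial_derivative_eq_0_outside[of K \<psi> x v] K that by (auto simp: compact_imp_closed)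
  obtain R where R: "\<And>x. x \<in> K \<Longrightarrow> norm x \<le> R"
    using compact_imp_bounded[OF K(1)] by (auto simp: bounded_iff)
  have "bounded (?D ` K)"
    using cont(1) K(1) by (intro compact_imp_bounded compact_continuous_image continuous_on_subset[OF cont(1)]) auto
  then obtain M where M: "\<And>x. x \<in> K \<Longrightarrow> \<bar>?D x\<bar> \<le> M"
    by (auto simp: bounded_iff)
  define B where "B = max M 0"
  have B: "\<bar>?D x\<bar> \<le> B" "0 \<le> B" for x
    using M[of x] D0[of x] by (cases "x \<in> K"; simp add: B_def)+
  have line: "((\<lambda>t. \<psi> (x + t *\<^sub>R v)) has_real_derivative ?D (x + t *\<^sub>R v)) (at t)" for x t
  proof -
    have h: "(\<psi> has_derivative (\<lambda>w. partial_derivative w \<psi> (x + t *\<^sub>R v))) (at (x + t *\<^sub>R v))"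
      by (rule Ck_has_derivative[OF C1]) simp
    have "((\<lambda>t. x + t *\<^sub>R v) has_derivative (\<lambda>s. s *\<^sub>R v)) (at t)"
      by (auto intro!: derivative_eq_intros)
    from has_derivative_compose[OF this h]
    have "((\<lambda>t. \<psi> (x + t *\<^sub>R v)) has_derivative (\<lambda>s. partial_derivative (s *\<^sub>R v) \<psi> (x + t *\<^sub>R v))) (at t)" .
    moreover have "partial_derivative (s *\<^sub>R v) \<psi> (x + t *\<^sub>R v) = ?D (x + t *\<^sub>R v) * s" for s
      using linear_cmul[OF has_derivative_linear[OF h], of s v] by simp
    ultimately show ?thesis
      by (simp add: has_field_derivative_def)
  qed
  \<comment> \<open>The step sizes lie in (0, 1], so the ball of radius \<open>R + 1\<close>
    contains the supports of all difference quotients; the mean value theorem bounds them by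
    \<open>B\<close>.\<close>
  define t :: "nat \<Rightarrow> real" where "t n = inverse (real (Suc n))" for n
  have t: "0 < t n" "t n \<le> 1" for n
    by (auto simp: t_def field_simps)
  have t_lim: "t \<longlonglongrightarrow> 0"
    unfolding t_def by (rule LIMSEQ_inverse_real_of_nat)
  define s where "s n x = (\<psi> (x + t n *\<^sub>R v) - \<psi> x) / t n" for n x
  have lim: "(\<lambda>n. s n x) \<longlonglongrightarrow> ?D x" for x
  proof -
    have "((\<lambda>h. (\<psi> (x + h *\<^sub>R v) - \<psi> x) / h) \<longlongrightarrow> ?D x) (at 0)"
      using line[of x 0] by (simp add: DERIV_def)
    moreover have "filterlim t (at 0) sequentially"
      unfolding filterlim_at using t_lim t(1) by (auto simp: less_imp_neq[symmetric])
    ultimately show ?thesis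
      unfolding s_def by (rule filterlim_compose)
  qed
  have bound: "\<bar>s n x\<bar> \<le> B * indicator (cball 0 (R + 1)) x" for n x
  proof (cases "norm x \<le> R + 1")
    case True
    have "\<exists>z. 0 < z \<and> z < t n \<and> \<psi> (x + t n *\<^sub>R v) - \<psi> (x + 0 *\<^sub>R v) = (t n - 0) * ?D (x + z *\<^sub>R v)"
      using t by (intro MVT2) (auto intro: line)
    then obtain z where "\<psi> (x + t n *\<^sub>R v) - \<psi> x = t n * ?D (x + z *\<^sub>R v)"
      by auto
    then have "s n x = ?D (x + z *\<^sub>R v)"
      using t(1)[of n] by (simp add: s_def)
    then show ?thesis
      using B True by (simp add: indicator_def)
  next
    case False
    have "norm (t n *\<^sub>R v) \<le> 1"
      using t[of n] v by simp
    then have "norm (x + t n *\<^sub>R v) > R"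
      using False norm_diff_ineq[of x "t n *\<^sub>R v"] by linarith
    then have "x + t n *\<^sub>R v \<notin> K" "x \<notin> K"
      using R False by force+
    then show ?thesis
      using K(2) B(2) by (simp add: s_def)
  qed
  have \<psi>: "\<psi> \<in> borel_measurable borel"
    using cont by (intro borel_measurable_continuous_onI)
  have \<psi>v: "(\<lambda>x. \<psi> (x + w)) \<in> borel_measurable borel" for w
    by (intro borel_measurable_continuous_onI continuous_on_compose2[OF cont(2)] continuous_intros) auto
  have int: "integrable lborel \<psi>"
    using integrable_continuous_compact_support[OF cont(2) K] .
  have intv: "integrable lborel (\<lambda>x. \<psi> (x + w))" for w
  proof (rule integrable_continuous_compact_support)
    show "compact ((\<lambda>x. x - w) ` K)"
      using K(1) by (intro compact_continuous_image continuous_intros)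
    show "\<psi> (x + w) = 0" if "x \<notin> (\<lambda>x. x - w) ` K" for x
      using that K(2)[of "x + w"] by (metis add_diff_cancel imageI)
  qed (auto intro!: continuous_intros continuous_on_compose2[OF cont(2)])
  have s0: "(\<integral>x. s n x \<partial>lborel) = 0" for n
    unfolding s_def using int intv[of "t n *\<^sub>R v"] integral_translation[OF \<psi>, of "t n *\<^sub>R v"]
    by simp
  have "(\<lambda>n. \<integral>x. s n x \<partial>lborel) \<longlonglongrightarrow> (\<integral>x. ?D x \<partial>lborel)"
  proof (rule integral_dominated_convergence)
    show "integrable lborel (\<lambda>x::'a. B * indicator (cball 0 (R + 1)) x :: real)"
      using emeasure_lborel_cball_finite[of "0::'a" "R + 1"]
      by (intro integrable_mult_right integrable_real_indicator) simp_all
    show "?D \<in> borel_measurable lborel"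
      using cont(1) by (simp add: borel_measurable_continuous_onI)
    show "s n \<in> borel_measurable lborel" for n
      unfolding s_def using \<psi> \<psi>v by simp
  qed (use lim bound in auto)
  then have "(\<lambda>n. 0) \<longlonglongrightarrow> (\<integral>x. ?D x \<partial>lborel)"
    by (simp only: s0)
  then show ?thesis
    by (rule LIMSEQ_unique) simp
qed

lemma partial_derivative_mult:
  fixes f g :: "'a::euclidean_space \<Rightarrow> real"
  assumes "Ck_on 1 f UNIV" "Ck_on 1 g UNIV"
  shows "partial_derivative v (\<lambda>x. f x * g x) x =
    f x * partial_derivative v g x + partial_derivative v f x * g x"
  by (intro partial_derivative_eq has_derivative_mult Ck_has_derivative[OF assms(1)]
      Ck_has_derivative[OF assms(2)]) auto

text \<open>The product of \<open>f\<close> and \<open>g\<close> inherits compact support from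
  \<open>f\<close>, so its partial derivative has integral 0; the product rule splits that
  integral.\<close>

lemma integration_by_parts:
  fixes f g :: "'a::euclidean_space \<Rightarrow> real"
  assumes C1: "Ck_on 1 f UNIV" "Ck_on 1 g UNIV" and v: "v \<in> Basis"
    and K: "compact K" "\<And>x. x \<notin> K \<Longrightarrow> f x = 0"
  shows "(\<integral>x. f x * partial_derivative v g x \<partial>lborel) = - (\<integral>x. partial_derivative v f x * g x \<partial>lborel)"
    and "integrable lborel (\<lambda>x. f x * partial_derivative v g x)"
    and "integrable lborel (\<lambda>x. partial_derivative v f x * g x)"
proof -
  have cont: "continuous_on UNIV f" "continuous_on UNIV g"
    "continuous_on UNIV (partial_derivative v f)" "continuous_on UNIV (partial_derivative v g)"
    using Ck_continuous[OF C1(1)] Ck_continuous[OF C1(2)] C1 v by auto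
  show int: "integrable lborel (\<lambda>x. f x * partial_derivative v g x)"
    "integrable lborel (\<lambda>x. partial_derivative v f x * g x)"
    using K cont partial_derivative_eq_0_outside[of K f _ v]
    by (auto intro!: integrable_continuous_compact_support[of _ K] continuous_on_mult
        simp: compact_imp_closed)
  have "(\<integral>x. partial_derivative v (\<lambda>x. f x * g x) x \<partial>lborel) = 0"
    using K by (intro integral_partial_derivative_eq_0[of _ v K] Ck_mult C1 v) auto
  then show "(\<integral>x. f x * partial_derivative v g x \<partial>lborel) = - (\<integral>x. partial_derivative v f x * g x \<partial>lborel)"
    using int by (simp add: partial_derivative_mult[OF C1])
qed

section \<open>The operator and its formal adjoint\<close>

text \<open>The formal adjoint of \<open>diff_op A b\<close>. The order of \<open>i\<close> and
  \<open>j\<close> is the one that two integrations by parts produce, and the one to which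
  \<open>dist_diff_op\<close> unfolds.\<close>

definition adjoint_op ::
    "(real^'n \<Rightarrow> real^'n^'n) \<Rightarrow> (real^'n \<Rightarrow> real^'n) \<Rightarrow> (real^'n \<Rightarrow> real) \<Rightarrow> real^'n \<Rightarrow> real" where
  "adjoint_op A b \<phi> x =
     (\<Sum>i\<in>UNIV. \<Sum>j\<in>UNIV.
        partial_derivative (axis j 1) (\<lambda>y. A y $ i $ j * partial_derivative (axis i 1) \<phi> y) x) -
     (\<Sum>i\<in>UNIV. partial_derivative (axis i 1) (\<lambda>y. b y $ i * \<phi> y) x)"

lemma diff_op_eq_sum:
  "diff_op A b g x =
     (\<Sum>i\<in>UNIV. partial_derivative (axis i 1)
        (\<lambda>y. \<Sum>j\<in>UNIV. A y $ i $ j * partial_derivative (axis j 1) g y) x) +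
     (\<Sum>i\<in>UNIV. b x $ i * partial_derivative (axis i 1) g x)"
  by (simp add: diff_op_def divergence_def gradient_def matrix_vector_mult_def inner_vec_def)

lemma axis_1_in_Basis: "axis i (1::real) \<in> Basis"
  by (simp add: axis_in_Basis_iff)

lemma C1_partial:
  assumes "Ck_on 2 g UNIV"
  shows "Ck_on 1 (partial_derivative (axis i (1::real)) (g :: real^'n \<Rightarrow> real)) UNIV"
  by (rule Ck_partial[OF _ axis_1_in_Basis]) (use assms in \<open>simp only: numeral_2_eq_2 One_nat_def\<close>)

lemma continuous_partial_C1:
  assumes "Ck_on 1 g UNIV"
  shows "continuous_on UNIV (partial_derivative (axis i (1::real)) (g :: real^'n \<Rightarrow> real))"
  using Ck_partial[of 0 g UNIV, OF _ axis_1_in_Basis] assms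
  by (simp only: Ck_on.simps(1) One_nat_def)

context
  fixes A :: "real^'n \<Rightarrow> real^'n^'n" and b :: "real^'n \<Rightarrow> real^'n"
  assumes A_C1: "\<And>i j. Ck_on 1 (\<lambda>x. A x $ i $ j) UNIV"
    and b_C1: "\<And>j. Ck_on 1 (\<lambda>x. b x $ j) UNIV"
begin

lemma C1_flux:
  assumes "Ck_on 2 g UNIV"
  shows "Ck_on 1 (\<lambda>y. \<Sum>j\<in>UNIV. A y $ i $ j * partial_derivative (axis j 1) g y) UNIV"
  by (intro Ck_sum Ck_mult A_C1 C1_partial assms)

lemma continuous_diff_op:
  assumes "Ck_on 2 g UNIV"
  shows "continuous_on UNIV (diff_op A b g)"
  unfolding diff_op_eq_sum[abs_def]
  by (intro continuous_intros continuous_partial_C1 C1_flux Ck_continuous[OF b_C1]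
      Ck_continuous[OF C1_partial] assms)

lemma continuous_adjoint_op:
  assumes "Ck_on 2 \<phi> UNIV"
  shows "continuous_on UNIV (adjoint_op A b \<phi>)"
  unfolding adjoint_op_def[abs_def]
  by (intro continuous_intros continuous_partial_C1 Ck_mult A_C1 b_C1 C1_partial assms
      Ck_on_le[OF assms]) simp

lemma adjoint_op_eq_0_outside:
  assumes "\<And>x. x \<notin> K \<Longrightarrow> \<phi> x = 0" "closed K" "x \<notin> K"
  shows "adjoint_op A b \<phi> x = 0"
proof -
  have "partial_derivative v \<phi> x = 0" if "x \<notin> K" for v x
    using partial_derivative_eq_0_outside[of K \<phi>, OF assms(1,2)] that by blast
  then show ?thesis
    unfolding adjoint_op_def using assms
    by (intro diff_eq_eq[THEN iffD2]) (simp add: partial_derivative_eq_0_outside[of K])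
qed

lemma integrable_adjoint_op:
  assumes "Ck_on 2 \<phi> UNIV" "continuous_on UNIV g"
    and "compact K" "\<And>x. x \<notin> K \<Longrightarrow> \<phi> x = 0"
  shows "integrable lborel (\<lambda>x. adjoint_op A b \<phi> x * g x)"
  using assms adjoint_op_eq_0_outside[of K \<phi>]
  by (intro integrable_continuous_compact_support[of _ K] continuous_on_mult continuous_adjoint_op)
     (auto simp: compact_imp_closed)

text \<open>Two integrations by parts treat the second-order part and one the drift. Boundary terms
  vanish because \<open>\<phi>\<close> has compact support, while \<open>g\<close> may grow
  freely.\<close>

lemma integral_adjoint_op:
  assumes \<phi>: "Ck_on 2 \<phi> UNIV" and g: "Ck_on 2 g UNIV"
    and K: "compact K" "\<And>x. x \<notin> K \<Longrightarrow> \<phi> x = 0"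
  shows "(\<integral>x. \<phi> x * diff_op A b g x \<partial>lborel) = (\<integral>x. adjoint_op A b \<phi> x * g x \<partial>lborel)"
proof -
  let ?d = "\<lambda>i. partial_derivative (axis i (1::real))"
  let ?F = "\<lambda>i y. \<Sum>j\<in>UNIV. A y $ i $ j * ?d j g y"
  let ?S = "\<lambda>i x. \<Sum>j\<in>UNIV. ?d j (\<lambda>y. A y $ i $ j * ?d i \<phi> y) x"
  let ?D = "\<lambda>i. ?d i (\<lambda>y. b y $ i * \<phi> y)"
  have C1: "Ck_on 1 \<phi> UNIV" "Ck_on 1 g UNIV"
    by (rule Ck_on_le[OF \<phi>] Ck_on_le[OF g], simp)+
  have K': "?d i \<phi> x = 0" if "x \<notin> K" for i x
    using partial_derivative_eq_0_outside[of K \<phi>, OF K(2) compact_imp_closed[OF K(1)]] that by blast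
  note ibp1 = integration_by_parts[OF C1(1) C1_flux[OF g] axis_1_in_Basis K]
  have Ai: "Ck_on 1 (\<lambda>x. A x $ i $ j * ?d i \<phi> x) UNIV" for i j
    by (intro Ck_mult A_C1 C1_partial \<phi>)
  have bi: "Ck_on 1 (\<lambda>x. b x $ i * \<phi> x) UNIV" for i
    by (intro Ck_mult b_C1 C1)
  note ibp2 = integration_by_parts[OF Ai C1(2) axis_1_in_Basis K(1)]
  note ibp3 = integration_by_parts[OF bi C1(2) axis_1_in_Basis K(1)]
  have second: "(\<integral>x. \<phi> x * ?d i (?F i) x \<partial>lborel) =
      (\<integral>x. (\<Sum>j\<in>UNIV. ?d j (\<lambda>y. A y $ i $ j * ?d i \<phi> y) x) * g x \<partial>lborel)" for i
  proof -
    \<comment> \<open>The first integration by parts takes the outer derivative off the flux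
      \<open>?F i\<close>, the second takes \<open>?d j\<close> off \<open>g\<close>; the two minus
      signs cancel.\<close>
    have "(\<integral>x. \<phi> x * ?d i (?F i) x \<partial>lborel) = - (\<integral>x. ?d i \<phi> x * ?F i x \<partial>lborel)"
      by (rule ibp1)
    also have "(\<integral>x. ?d i \<phi> x * ?F i x \<partial>lborel) =
        (\<integral>x. (\<Sum>j\<in>UNIV. (A x $ i $ j * ?d i \<phi> x) * ?d j g x) \<partial>lborel)"
      by (simp add: sum_distrib_left mult_ac)
    also have "\<dots> = (\<Sum>j\<in>UNIV. \<integral>x. (A x $ i $ j * ?d i \<phi> x) * ?d j g x \<partial>lborel)"
      by (intro Bochner_Integration.integral_sum ibp2(2)) (use K' in auto)
    also have "\<dots> = (\<Sum>j\<in>UNIV. - (\<integral>x. ?d j (\<lambda>y. A y $ i $ j * ?d i \<phi> y) x * g x \<partial>lborel))"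
      by (intro sum.cong refl ibp2(1)) (use K' in auto)
    also have "\<dots> = - (\<integral>x. (\<Sum>j\<in>UNIV. ?d j (\<lambda>y. A y $ i $ j * ?d i \<phi> y) x) * g x \<partial>lborel)"
      unfolding sum_distrib_right sum_negf
      by (subst Bochner_Integration.integral_sum) (use K' in \<open>auto intro!: ibp2(3)\<close>)
    finally show ?thesis by simp
  qed
  have int2: "integrable lborel (\<lambda>x. (\<Sum>j\<in>UNIV. ?d j (\<lambda>y. A y $ i $ j * ?d i \<phi> y) x) * g x)" for i
    unfolding sum_distrib_right
    by (intro Bochner_Integration.integrable_sum ibp2(3)) (use K' in auto)
  have first: "(\<integral>x. \<phi> x * (b x $ i * ?d i g x) \<partial>lborel) =
      - (\<integral>x. ?d i (\<lambda>y. b y $ i * \<phi> y) x * g x \<partial>lborel)"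
    "integrable lborel (\<lambda>x. \<phi> x * (b x $ i * ?d i g x))"
    "integrable lborel (\<lambda>x. ?d i (\<lambda>y. b y $ i * \<phi> y) x * g x)" for i
    using ibp3[of i i] K(2) by (auto simp: mult_ac)
  have "(\<integral>x. \<phi> x * diff_op A b g x \<partial>lborel) =
      (\<integral>x. (\<Sum>i\<in>UNIV. \<phi> x * ?d i (?F i) x) + (\<Sum>i\<in>UNIV. \<phi> x * (b x $ i * ?d i g x)) \<partial>lborel)"
    by (simp add: diff_op_eq_sum distrib_left sum_distrib_left)
  also have "\<dots> = (\<Sum>i\<in>UNIV. \<integral>x. \<phi> x * ?d i (?F i) x \<partial>lborel) +
      (\<Sum>i\<in>UNIV. \<integral>x. \<phi> x * (b x $ i * ?d i g x) \<partial>lborel)"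
    by (subst Bochner_Integration.integral_add)
       (auto intro!: Bochner_Integration.integrable_sum ibp1(2) first(2)
          simp: Bochner_Integration.integral_sum ibp1(2) first(2))
  also have "\<dots> = (\<Sum>i\<in>UNIV. \<integral>x. ?S i x * g x \<partial>lborel) - (\<Sum>i\<in>UNIV. \<integral>x. ?D i x * g x \<partial>lborel)"
    by (simp only: first(1) second sum_negf)
  also have "\<dots> = (\<integral>x. (\<Sum>i\<in>UNIV. ?S i x * g x) - (\<Sum>i\<in>UNIV. ?D i x * g x) \<partial>lborel)"
    using int2 first(3)
    by (subst Bochner_Integration.integral_diff)
       (simp_all only: Bochner_Integration.integral_sum Bochner_Integration.integrable_sum)
  also have "\<dots> = (\<integral>x. adjoint_op A b \<phi> x * g x \<partial>lborel)"
    unfolding adjoint_op_def left_diff_distrib sum_distrib_right[of _ UNIV] ..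
  finally show ?thesis .
qed

text \<open>The flux of \<open>h (u x)\<close> is \<open>h' (u x)\<close> times the flux of
  \<open>u\<close>; in its divergence, the derivative of the factor \<open>h' (u x)\<close> yields
  the quadratic term.\<close>

lemma diff_op_compose:
  assumes u: "Ck_on 2 u UNIV"
    and h: "\<And>t. (h has_real_derivative h' t) (at t)"
    and h': "\<And>t. (h' has_real_derivative h'' t) (at t)"
  shows "diff_op A b (\<lambda>x. h (u x)) x =
    h' (u x) * diff_op A b u x + h'' (u x) * ((A x *v gradient u x) \<bullet> gradient u x)"
proof -
  let ?d = "\<lambda>i. partial_derivative (axis i (1::real))"
  have du: "(u has_derivative (\<lambda>v. partial_derivative v u x)) (at x)" for x
    by (rule Ck_has_derivative[OF u]) simp
  have comp: "((\<lambda>x. k (u x)) has_derivative (\<lambda>v. k' * partial_derivative v u x)) (at x)"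
    if "(k has_real_derivative k') (at (u x))" for k k' x
    using has_derivative_compose[OF du that[unfolded has_field_derivative_def]] .
  let ?F = "\<lambda>i y. \<Sum>j\<in>UNIV. A y $ i $ j * ?d j u y"
  have d1: "?d j (\<lambda>x. h (u x)) x = h' (u x) * ?d j u x" for j x
    by (intro partial_derivative_eq comp h)
  have "?d i (\<lambda>y. \<Sum>j\<in>UNIV. A y $ i $ j * ?d j (\<lambda>x. h (u x)) y) x =
      h' (u x) * ?d i (?F i) x + h'' (u x) * ?d i u x * ?F i x" for i
  proof -
    have "(\<lambda>y. \<Sum>j\<in>UNIV. A y $ i $ j * ?d j (\<lambda>x. h (u x)) y) = (\<lambda>y. h' (u y) * ?F i y)"
      by (simp add: d1 sum_distrib_left mult_ac)
    then show ?thesis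
      by (simp only:)
         (intro partial_derivative_eq has_derivative_mult comp h' Ck_has_derivative[OF C1_flux[OF u]] zero_less_one)
  qed
  then show ?thesis
    by (simp add: diff_op_eq_sum d1 sum.distrib sum_distrib_left distrib_left mult_ac
        inner_vec_def matrix_vector_mult_def gradient_def)
qed

end

section \<open>Bump functions\<close>

text \<open>The functions t^(-n) exp (-1/t), extended by 0. The derivative of a member is a linear
  combination of members, so one induction on the order, with \<open>n\<close> arbitrary, shows all
  of them smooth.\<close>

definition flat_exp :: "nat \<Rightarrow> real \<Rightarrow> real" where
  "flat_exp n t = (if t \<le> 0 then 0 else inverse t ^ n * exp (- inverse t))"

lemma has_derivative_flat_exp:
  "(flat_exp n has_real_derivative flat_exp (n + 2) t - real n * flat_exp (n + 1) t) (at t)"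
proof -
  consider "t < 0" | "t = 0" | "t > 0" by linarith
  then show ?thesis
  proof cases
    case 1
    have "((\<lambda>_. 0) has_real_derivative 0) (at t)"
      by simp
    then have "(flat_exp n has_real_derivative 0) (at t)"
      by (rule has_field_derivative_transform_within_open[of _ _ _ "{..<0}"])
         (use 1 in \<open>auto simp: flat_exp_def\<close>)
    then show ?thesis using 1 by (simp add: flat_exp_def)
  next
    case 2
    \<comment> \<open>Since \<open>flat_exp n 0 = 0\<close>, this is the difference quotient at 0.
      From the right, the substitution s = 1/h turns it into s^(n+1) / exp s.\<close>
    have "((\<lambda>h. flat_exp n h / h) \<longlongrightarrow> 0) (at_left 0)"
      by (rule Lim_transform_eventually[OF tendsto_const])
         (auto simp: eventually_at_filter flat_exp_def)
    moreover have "((\<lambda>h. flat_exp n h / h) \<longlongrightarrow> 0) (at_right 0)"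
    proof (rule Lim_transform_eventually)
      show "((\<lambda>h. inverse h ^ Suc n / exp (inverse h)) \<longlongrightarrow> (0::real)) (at_right 0)"
        by (rule filterlim_compose[OF tendsto_power_div_exp_0 filterlim_inverse_at_top_right])
      show "\<forall>\<^sub>F h in at_right 0. inverse h ^ Suc n / exp (inverse h) = flat_exp n h / h"
        by (auto simp: eventually_at_filter flat_exp_def exp_minus field_simps)
    qed
    ultimately have "((\<lambda>h. flat_exp n h / h) \<longlongrightarrow> 0) (at 0)"
      by (rule filterlim_split_at)
    then show ?thesis
      using 2 by (simp add: DERIV_def flat_exp_def)
  next
    case 3
    have pow: "((\<lambda>t. inverse t ^ n) has_real_derivative - (real n * inverse t ^ (n + 1))) (at t)"
    proof (induction n)
      case (Suc n)
      have "((\<lambda>t. inverse t * inverse t ^ n) has_real_derivative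
          inverse t * - (real n * inverse t ^ (n + 1)) + - (inverse t ^ 2) * inverse t ^ n) (at t)"
        by (rule DERIV_mult'[OF _ Suc]) (use 3 in \<open>auto intro!: derivative_eq_intros simp: power2_eq_square\<close>)
      then show ?case
        by (simp add: algebra_simps power2_eq_square)
    qed simp
    have "((\<lambda>t. exp (- inverse t)) has_real_derivative exp (- inverse t) * inverse t ^ 2) (at t)"
      using 3 by (auto intro!: derivative_eq_intros simp: power2_eq_square)
    from DERIV_mult'[OF pow this]
    have "((\<lambda>t. inverse t ^ n * exp (- inverse t)) has_real_derivative
        flat_exp (n + 2) t - real n * flat_exp (n + 1) t) (at t)"
      using 3 by (simp add: flat_exp_def algebra_simps power2_eq_square)
    then show ?thesis
      by (rule has_field_derivative_transform_within_open[of _ _ _ "{0<..}"])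
         (use 3 in \<open>auto simp: flat_exp_def\<close>)
  qed
qed

lemma Ck_realI:
  fixes f f' :: "real \<Rightarrow> real"
  assumes "\<And>t. (f has_real_derivative f' t) (at t)" "Ck_on k f' UNIV"
  shows "Ck_on (Suc k) f UNIV"
  by (rule Ck_SucI[where f' = "\<lambda>t s. f' t * s"])
     (use assms in \<open>auto simp: has_field_derivative_def\<close>)

lemma Ck_flat_exp: "Ck_on k (flat_exp n) UNIV"
proof (induction k arbitrary: n)
  case 0
  then show ?case
    using DERIV_continuous[OF has_derivative_flat_exp] by (auto intro!: continuous_at_imp_continuous_on)
next
  case (Suc k)
  show ?case
    by (rule Ck_realI[OF has_derivative_flat_exp]) (intro Ck_diff Ck_mult Ck_const Suc.IH)
qed

text \<open>Composes the flat exponential with r^2 - |x - x0|^2, which is positive exactly on the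
  open ball.\<close>

lemma exists_smooth_bump:
  fixes x0 :: "'a::euclidean_space"
  assumes "0 < r"
  obtains \<phi> :: "'a \<Rightarrow> real" where "\<And>k. Ck_on k \<phi> UNIV" "\<And>x. 0 \<le> \<phi> x"
    "\<And>x. 0 < \<phi> x \<longleftrightarrow> x \<in> ball x0 r" "\<And>x. x \<notin> cball x0 r \<Longrightarrow> \<phi> x = 0"
proof
  \<comment> \<open>The squared distance is spelled out in coordinates so that the closure rules for
    \<open>Ck_on\<close> apply to it directly.\<close>
  let ?N = "\<lambda>x. \<Sum>j\<in>Basis. (x \<bullet> j - x0 \<bullet> j) * (x \<bullet> j - x0 \<bullet> j)"
  let ?\<phi> = "\<lambda>x. flat_exp 0 (r\<^sup>2 - ?N x)"
  have N: "?N x = (dist x0 x)\<^sup>2" for x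
    unfolding dist_norm power2_norm_eq_inner euclidean_inner[of "x0 - x" "x0 - x"]
    by (simp add: inner_diff_left algebra_simps)
  show "Ck_on k ?\<phi> UNIV" for k
    by (intro Ck_compose[OF Ck_flat_exp] Ck_diff Ck_const Ck_sum Ck_mult
        Ck_linear[OF bounded_linear_inner_left])
  show "0 \<le> ?\<phi> x" for x
    by (simp add: flat_exp_def)
  have "r\<^sup>2 - ?N x > 0 \<longleftrightarrow> dist x0 x < r" for x
    using assms unfolding N by (simp add: power2_less_imp_less abs_le_square_iff[symmetric] flip: not_le)
  then show pos: "0 < ?\<phi> x \<longleftrightarrow> x \<in> ball x0 r" for x
    by (simp add: flat_exp_def flip: not_le)
  show "?\<phi> x = 0" if "x \<notin> cball x0 r" for x
  proof -
    have "\<not> 0 < ?\<phi> x"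
      unfolding pos using that by simp
    then show ?thesis
      by (simp add: flat_exp_def split: if_splits)
  qed
qed

text \<open>The set where \<open>f\<close> and \<open>g\<close> differ is open and null, and a
  nonempty open set is not negligible.\<close>

lemma continuous_AE_eq:
  fixes f g :: "'a::euclidean_space \<Rightarrow> real"
  assumes "continuous_on UNIV f" "continuous_on UNIV g" "AE x in lborel. f x = g x"
  shows "f x = g x"
proof -
  have op: "open {x. f x \<noteq> g x}"
    by (rule open_Collect_neq[OF assms(1,2)])
  have "{x. f x \<noteq> g x} \<in> null_sets lborel"
    using assms(3) op by (subst AE_iff_null_sets) auto
  then have "negligible {x. f x \<noteq> g x}"
    using negligible_iff_null_sets null_sets_completionI by blast
  then have "{x. f x \<noteq> g x} = {}"
    using open_not_negligible[OF op] by blast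
  then show ?thesis by blast
qed

lemma diff_op_const:
  fixes A :: "real^'n \<Rightarrow> real^'n^'n"
  shows "diff_op A b (\<lambda>_. c) x = 0"
proof -
  have "partial_derivative v (\<lambda>_::real^'n. c) = (\<lambda>_. 0)" for v and c :: real
    using partial_derivative_eq[OF has_derivative_const] by auto
  then show ?thesis
    by (simp add: diff_op_eq_sum)
qed

text \<open>The preimage of \<open>E\<close> under right translation by \<open>y\<close> is its
  image under right translation by \<open>iv y\<close>. This turns invariance for images into
  invariance of the pushforward, the form that integrals can use.\<close>

lemma distr_right_translation:
  fixes mul :: "'a::euclidean_space \<Rightarrow> 'a \<Rightarrow> 'a"
  assumes "group mul e iv" "lebesgue_right_invariant mul"
    and cont: "\<And>y. continuous_on UNIV (\<lambda>x. mul x y)"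
  shows "distr lborel borel (\<lambda>x. mul x y) = lborel"
proof (rule measure_eqI)
  fix E
  assume "E \<in> sets (distr lborel borel (\<lambda>x. mul x y))"
  then have E: "E \<in> sets borel" by simp
  interpret group mul e iv by fact
  have meas: "(\<lambda>x. mul x y) \<in> borel_measurable lborel"
    using cont by (simp add: borel_measurable_continuous_onI)
  have vimage: "(\<lambda>x. mul x y) -` E = (\<lambda>x. mul x (iv y)) ` E"
  proof (intro set_eqI iffI)
    fix x
    assume "x \<in> (\<lambda>x. mul x y) -` E"
    then show "x \<in> (\<lambda>x. mul x (iv y)) ` E"
      by (intro image_eqI[of _ _ "mul x y"]) (simp_all add: assoc)
  qed (auto simp: assoc)
  have "emeasure (distr lborel borel (\<lambda>x. mul x y)) E = emeasure lborel ((\<lambda>x. mul x y) -` E)"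
    using E meas by (simp add: emeasure_distr)
  also have "\<dots> = emeasure lebesgue ((\<lambda>x. mul x y) -` E)"
    using measurable_sets[OF meas E] by simp
  also have "\<dots> = emeasure lebesgue E"
    using assms(2) E unfolding vimage lebesgue_right_invariant_def by simp
  finally show "emeasure (distr lborel borel (\<lambda>x. mul x y)) E = emeasure lborel E"
    using E by simp
qed simp

section \<open>Convolution and integrable supersolutions\<close>

lemma continuous_fixed_right:
  assumes "continuous_on UNIV (\<lambda>(x, y). f x y)"
  shows "continuous_on UNIV (\<lambda>x. f x y)"
proof -
  have "continuous_on UNIV (\<lambda>x. (x, y))"
    by (intro continuous_intros)
  from continuous_on_compose2[OF assms this] show ?thesis by simp
qed

text \<open>Collects what the Fubini argument rests on: joint continuity, for measurability on the
  product space, and right invariance in pushforward form.\<close>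

locale right_invariant_measure =
  fixes mul :: "'a::euclidean_space \<Rightarrow> 'a \<Rightarrow> 'a"
  assumes continuous_mul: "continuous_on UNIV (\<lambda>(x, y). mul x y)"
    and distr_mul: "\<And>y. distr lborel borel (\<lambda>x. mul x y) = lborel"
begin

lemma measurable_mul [measurable]:
  "(\<lambda>p. mul (fst p) (snd p)) \<in> borel_measurable (lborel \<Otimes>\<^sub>M lborel)"
  using borel_measurable_continuous_onI[OF continuous_mul]
  by (simp add: lborel_prod case_prod_unfold)

lemma measurable_mul_left [measurable]: "(\<lambda>x. mul x y) \<in> borel_measurable borel"
  by (rule borel_measurable_continuous_onI[OF continuous_fixed_right[OF continuous_mul]])

lemma nn_integral_mul:
  assumes [measurable]: "F \<in> borel_measurable borel"
  shows "(\<integral>\<^sup>+x. F (mul x y) \<partial>lborel) = (\<integral>\<^sup>+x. F x \<partial>lborel)"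
proof -
  have "(\<integral>\<^sup>+x. F x \<partial>distr lborel borel (\<lambda>x. mul x y)) = (\<integral>\<^sup>+x. F (mul x y) \<partial>lborel)"
    by (rule nn_integral_distr) simp_all
  then show ?thesis by (simp add: distr_mul)
qed

lemma lebesgue_integral_mul:
  assumes [measurable]: "(F :: 'a \<Rightarrow> real) \<in> borel_measurable borel"
  shows "(\<integral>x. F (mul x y) \<partial>lborel) = (\<integral>x. F x \<partial>lborel)"
proof -
  have "(\<integral>x. F x \<partial>distr lborel borel (\<lambda>x. mul x y)) = (\<integral>x. F (mul x y) \<partial>lborel)"
    by (rule integral_distr) simp_all
  then show ?thesis by (simp add: distr_mul)
qed

text \<open>After exchanging the integrals, the inner integral over \<open>z\<close> sees
  \<open>F\<close> right-translated by \<open>y\<close>, so right invariance makes it independent of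
  \<open>y\<close>.\<close>

lemma nn_integral_convolution:
  assumes [measurable]: "g \<in> borel_measurable borel" "F \<in> borel_measurable borel"
  shows "(\<integral>\<^sup>+z. \<integral>\<^sup>+y. g y * F (mul z y) \<partial>lborel \<partial>lborel) =
    (\<integral>\<^sup>+y. g y \<partial>lborel) * (\<integral>\<^sup>+x. F x \<partial>lborel)"
proof -
  have "(\<integral>\<^sup>+z. \<integral>\<^sup>+y. g y * F (mul z y) \<partial>lborel \<partial>lborel) =
      (\<integral>\<^sup>+y. \<integral>\<^sup>+z. g y * F (mul z y) \<partial>lborel \<partial>lborel)"
    by (rule lborel_pair.Fubini'[symmetric]) (simp add: split_beta)
  also have "\<dots> = (\<integral>\<^sup>+y. g y * (\<integral>\<^sup>+x. F x \<partial>lborel) \<partial>lborel)"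
    by (simp add: nn_integral_cmult nn_integral_mul)
  also have "\<dots> = (\<integral>\<^sup>+y. g y \<partial>lborel) * (\<integral>\<^sup>+x. F x \<partial>lborel)"
    by (rule nn_integral_multc) simp
  finally show ?thesis .
qed

text \<open>The nonnegative version, applied to absolute values, gives joint integrability, so
  Fubini applies to signed functions.\<close>

lemma integral_convolution:
  fixes g F :: "'a \<Rightarrow> real"
  assumes g: "integrable lborel g" and F: "integrable lborel F"
  shows "integrable lborel (\<lambda>z. \<integral>y. g y * F (mul z y) \<partial>lborel)"
    and "(\<integral>z. \<integral>y. g y * F (mul z y) \<partial>lborel \<partial>lborel) = (\<integral>y. g y \<partial>lborel) * (\<integral>x. F x \<partial>lborel)"
proof -
  have [measurable]: "g \<in> borel_measurable borel" "F \<in> borel_measurable borel"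
    using borel_measurable_integrable[OF g] borel_measurable_integrable[OF F] by simp_all
  have int: "integrable (lborel \<Otimes>\<^sub>M lborel) (\<lambda>(z, y). g y * F (mul z y))"
  proof (rule integrableI_bounded)
    have "(\<integral>\<^sup>+p. ennreal (norm (case p of (z, y) \<Rightarrow> g y * F (mul z y))) \<partial>(lborel \<Otimes>\<^sub>M lborel)) =
        (\<integral>\<^sup>+z. \<integral>\<^sup>+y. ennreal \<bar>g y\<bar> * ennreal \<bar>F (mul z y)\<bar> \<partial>lborel \<partial>lborel)"
      by (subst lborel.nn_integral_fst[symmetric]) (simp_all add: split_beta abs_mult ennreal_mult)
    also have "\<dots> = (\<integral>\<^sup>+y. ennreal \<bar>g y\<bar> \<partial>lborel) * (\<integral>\<^sup>+x. ennreal \<bar>F x\<bar> \<partial>lborel)"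
      by (rule nn_integral_convolution) simp_all
    also have "\<dots> < \<infinity>"
      using g F by (simp add: integrable_iff_bounded ennreal_mult_less_top)
    finally show "(\<integral>\<^sup>+p. ennreal (norm (case p of (z, y) \<Rightarrow> g y * F (mul z y))) \<partial>(lborel \<Otimes>\<^sub>M lborel)) < \<infinity>" .
  qed (simp add: split_beta)
  show "integrable lborel (\<lambda>z. \<integral>y. g y * F (mul z y) \<partial>lborel)"
    using lborel_pair.integrable_fst[OF int] by simp
  have "(\<integral>z. \<integral>y. g y * F (mul z y) \<partial>lborel \<partial>lborel) = (\<integral>y. \<integral>z. g y * F (mul z y) \<partial>lborel \<partial>lborel)"
    using lborel_pair.Fubini_integral[OF int] by simp
  also have "\<dots> = (\<integral>y. g y * (\<integral>x. F x \<partial>lborel) \<partial>lborel)"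
    by (simp add: lebesgue_integral_mul)
  finally show "(\<integral>z. \<integral>y. g y * F (mul z y) \<partial>lborel \<partial>lborel) = (\<integral>y. g y \<partial>lborel) * (\<integral>x. F x \<partial>lborel)"
    by simp
qed

end

section \<open>Left translates and integrable supersolutions on the group\<close>

lemma Ck_translation:
  fixes mul :: "real^'n \<Rightarrow> real^'n \<Rightarrow> real^'n"
  assumes "Ck_on k (\<lambda>(x, y). mul x y) UNIV" "Ck_on k (f :: real^'n \<Rightarrow> real) UNIV"
  shows "Ck_on k (\<lambda>y. f (mul z y)) UNIV"
proof -
  have "Ck_on k (\<lambda>p. f (case p of (x, y) \<Rightarrow> mul x y)) UNIV"
    by (rule Ck_compose[OF assms(2,1)])
  \<comment> \<open>The pair \<open>(z, y)\<close> is written as a constant plus a linear function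
    of \<open>y\<close>, hence is of class C^k in \<open>y\<close>.\<close>
  moreover have "Ck_on k (\<lambda>y. (z, 0) + (0, y)) UNIV"
    by (intro Ck_add Ck_const Ck_linear bounded_linear_Pair bounded_linear_zero bounded_linear_ident)
  ultimately show ?thesis
    using Ck_compose[of k "\<lambda>p. f (case p of (x, y) \<Rightarrow> mul x y)" "\<lambda>y. (z, 0) + (0, y)"] by simp
qed

lemma integrable_supersolution_imp_solution:
  fixes A :: "real^'n \<Rightarrow> real^'n^'n" and f :: "real^'n \<Rightarrow> real"
  assumes A: "\<And>i j. Ck_on 1 (\<lambda>x. A x $ i $ j) UNIV"
    and b: "\<And>j. Ck_on 1 (\<lambda>x. b x $ j) UNIV"
    and lie: "lie_group mul e iv"
    and L_inv: "left_translation_invariant mul (diff_op A b)"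
    and leb_right: "lebesgue_right_invariant mul"
    and f: "smooth_on f UNIV" "integrable lborel f"
    and super: "\<And>x. diff_op A b f x \<le> 0"
  shows "diff_op A b f x = 0"
proof -
  have mul: "Ck_on k (\<lambda>(x, y). mul x y) UNIV" for k
    using lie by (simp add: lie_group_def smooth_on_def)
  have cont_mul: "continuous_on UNIV (\<lambda>(x, y). mul x y)"
    by (rule Ck_continuous[OF mul])
  note cont_mul1 = continuous_fixed_right[OF cont_mul]
  interpret right_invariant_measure mul
    using lie leb_right cont_mul cont_mul1
    by unfold_locales (auto simp: lie_group_def intro: distr_right_translation)
  obtain \<eta> :: "real^'n \<Rightarrow> real" where \<eta>: "\<And>k. Ck_on k \<eta> UNIV" "\<And>x. 0 \<le> \<eta> x"
      "\<And>x. 0 < \<eta> x \<longleftrightarrow> x \<in> ball 0 1" "\<And>x. x \<notin> cball 0 1 \<Longrightarrow> \<eta> x = 0"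
    using exists_smooth_bump[of 1 0] by auto
  let ?q = "\<lambda>x. - diff_op A b f x"
  let ?\<psi> = "adjoint_op A b \<eta>"
  have f2: "Ck_on k f UNIV" for k
    using f(1) by (rule smooth_imp_Ck)
  note cont_q = continuous_on_minus[OF continuous_diff_op[OF A b f2]]
  have [measurable]: "\<eta> \<in> borel_measurable borel" "diff_op A b f \<in> borel_measurable borel"
    by (rule borel_measurable_continuous_onI Ck_continuous[OF \<eta>(1)] continuous_diff_op[OF A b f2])+
  have fz: "Ck_on k (\<lambda>y. f (mul z y)) UNIV" for k z
    by (rule Ck_translation[OF mul f2])
  have Lfz: "diff_op A b (\<lambda>y. f (mul z y)) y = diff_op A b f (mul z y)" for y z
    using L_inv f(1) by (simp add: left_translation_invariant_def)
  \<comment> \<open>By left invariance the operator maps a left translate of \<open>f\<close> to the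
    left translate of \<L> f, so duality with \<open>\<eta>\<close> can be used for each fixed
    \<open>z\<close>.\<close>
  have "(\<integral>y. \<eta> y * diff_op A b (\<lambda>y. f (mul z y)) y \<partial>lborel) = (\<integral>y. ?\<psi> y * f (mul z y) \<partial>lborel)" for z
    by (rule integral_adjoint_op[OF A b \<eta>(1) fz compact_cball[of 0 1]]) (rule \<eta>(4))
  then have parts: "(\<integral>y. \<eta> y * ?q (mul z y) \<partial>lborel) = - (\<integral>y. ?\<psi> y * f (mul z y) \<partial>lborel)" for z
    by (simp add: Lfz)
  have "integrable lborel (\<lambda>y. ?\<psi> y * 1)"
    by (rule integrable_adjoint_op[OF A b \<eta>(1) continuous_on_const compact_cball[of 0 1]]) (rule \<eta>(4))
  then have \<psi>_int: "integrable lborel ?\<psi>"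
    by simp
  \<comment> \<open>Testing the duality with the constant 1 shows that the adjoint of
    \<open>\<eta>\<close> has integral 0.\<close>
  have "(\<integral>y. \<eta> y * diff_op A b (\<lambda>_. 1) y \<partial>lborel) = (\<integral>y. ?\<psi> y * 1 \<partial>lborel)"
    by (rule integral_adjoint_op[OF A b \<eta>(1) Ck_const compact_cball[of 0 1]]) (rule \<eta>(4))
  then have "(\<integral>y. ?\<psi> y \<partial>lborel) = 0"
    by (simp add: diff_op_const)
  then have conv: "integrable lborel (\<lambda>z. \<integral>y. \<eta> y * ?q (mul z y) \<partial>lborel)"
      "(\<integral>z. \<integral>y. \<eta> y * ?q (mul z y) \<partial>lborel \<partial>lborel) = 0"
    unfolding parts using integral_convolution[OF \<psi>_int f(2)] by simp_all
  have int_z: "integrable lborel (\<lambda>y. \<eta> y * ?q (mul z y))" for z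
    using \<eta>(4) continuous_diff_op[OF A b fz, of z]
    by (intro integrable_continuous_compact_support[of _ "cball 0 1"] continuous_on_mult
        Ck_continuous[OF \<eta>(1)] continuous_on_minus) (auto simp: Lfz[abs_def])
  have nonneg: "0 \<le> \<eta> y * ?q (mul z y)" for y z
    using \<eta>(2) super by (simp add: mult_nonneg_nonpos)
  \<comment> \<open>By Tonelli and the vanishing double integral, this product in [0, \<infinity>]
    is 0; so one factor is 0, even if the other were infinite.\<close>
  have "(\<integral>\<^sup>+y. ennreal (\<eta> y) \<partial>lborel) * (\<integral>\<^sup>+x. ennreal (?q x) \<partial>lborel) =
      (\<integral>\<^sup>+z. \<integral>\<^sup>+y. ennreal (\<eta> y) * ennreal (?q (mul z y)) \<partial>lborel \<partial>lborel)"
    by (rule nn_integral_convolution[symmetric]) simp_all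
  also have "\<dots> = (\<integral>\<^sup>+z. \<integral>\<^sup>+y. ennreal (\<eta> y * ?q (mul z y)) \<partial>lborel \<partial>lborel)"
    by (intro nn_integral_cong ennreal_mult[symmetric]) (use \<eta>(2) super in auto)
  also have "\<dots> = (\<integral>\<^sup>+z. ennreal (\<integral>y. \<eta> y * ?q (mul z y) \<partial>lborel) \<partial>lborel)"
    by (intro nn_integral_cong nn_integral_eq_integral int_z AE_I2 nonneg)
  also have "\<dots> = ennreal 0"
    unfolding conv(2)[symmetric]
    by (intro nn_integral_eq_integral conv(1) AE_I2 Bochner_Integration.integral_nonneg nonneg)
  finally have "(\<integral>\<^sup>+y. ennreal (\<eta> y) \<partial>lborel) = 0 \<or> (\<integral>\<^sup>+x. ennreal (?q x) \<partial>lborel) = 0"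
    by simp
  moreover have "(\<integral>\<^sup>+y. ennreal (\<eta> y) \<partial>lborel) \<noteq> 0"
  proof
    assume "(\<integral>\<^sup>+y. ennreal (\<eta> y) \<partial>lborel) = 0"
    then have "AE y in lborel. \<eta> y = 0"
      using \<eta>(2) by (auto simp: nn_integral_0_iff_AE elim!: AE_mp intro!: AE_I2 antisym)
    then have "\<eta> 0 = 0"
      by (intro continuous_AE_eq Ck_continuous[OF \<eta>(1)] continuous_on_const)
    then show False
      using \<eta>(3)[of 0] by simp
  qed
  ultimately have "AE x in lborel. ?q x = 0"
    using super by (auto simp: nn_integral_0_iff_AE elim!: AE_mp intro!: AE_I2 antisym)
  then have "?q x = 0"
    by (intro continuous_AE_eq cont_q continuous_on_const)
  then show ?thesis by simp
qed

section \<open>Test functions and distributions\<close>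

lemma Ck_real_DERIV:
  fixes f :: "real \<Rightarrow> real"
  assumes "Ck_on k f UNIV" "0 < k"
  shows "(f has_real_derivative partial_derivative 1 f t) (at t)"
proof -
  have d: "(f has_derivative (\<lambda>v. partial_derivative v f t)) (at t)"
    by (rule Ck_has_derivative[OF assms])
  have "partial_derivative v f t = partial_derivative 1 f t * v" for v
    using linear_cmul[OF has_derivative_linear[OF d], of v 1] by simp
  then show ?thesis
    unfolding has_field_derivative_def by (rule has_derivative_eq_rhs[OF d ext])
qed

text \<open>The derivative 1 - tanh^2 is a polynomial in tanh itself, so the induction
  closes.\<close>

lemma Ck_tanh: "Ck_on k (tanh :: real \<Rightarrow> real) UNIV"
proof (induction k)
  case 0
  then show ?case by (auto intro!: continuous_intros)
next
  case (Suc k)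
  show ?case
    by (rule Ck_realI[where f' = "\<lambda>t. 1 - tanh t * tanh t"])
       (auto intro!: derivative_eq_intros Ck_diff Ck_const Ck_mult Suc simp: power2_eq_square)
qed

lemma Ck_exp_minus: "Ck_on k (\<lambda>t::real. exp (- t)) UNIV"
proof (induction k)
  case 0
  then show ?case by (auto intro!: continuous_intros)
next
  case (Suc k)
  show ?case
    by (rule Ck_realI[where f' = "\<lambda>t. - exp (- t)"])
       (auto intro!: derivative_eq_intros Ck_minus Suc)
qed

text \<open>Domination, uniform in \<open>k\<close>, for the smooth approximations
  \<open>s * tanh (k * s)\<close> of the absolute value.\<close>

lemma abs_mult_tanh_le: "\<bar>s * tanh (k * s)\<bar> \<le> \<bar>s :: real\<bar>"
proof -
  have "\<bar>tanh (k * s)\<bar> \<le> 1"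
    using tanh_real_bounds[of "k * s"] by auto
  from mult_left_mono[OF this, of "\<bar>s\<bar>"] show ?thesis
    by (simp only: abs_mult abs_ge_zero mult_1_right)
qed

lemma mult_tanh_tendsto_abs: "(\<lambda>k. s * tanh (real k * s)) \<longlonglongrightarrow> \<bar>s\<bar>"
proof (cases "s = 0")
  case False
  \<comment> \<open>The left side is even in \<open>s\<close>; for nonzero \<open>s\<close> its
    limit is thus governed by that of tanh at plus infinity.\<close>
  have eq: "s * tanh (real k * s) = \<bar>s\<bar> * tanh (real k * \<bar>s\<bar>)" for k
    by (cases "s \<ge> 0") auto
  have "filterlim (\<lambda>k. real k * \<bar>s\<bar>) at_top sequentially"
    using False by (intro filterlim_at_top_mult_tendsto_pos[OF tendsto_const _ filterlim_real_sequentially]) simp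
  from filterlim_compose[OF tanh_real_at_top this]
  have "(\<lambda>k. \<bar>s\<bar> * tanh (real k * \<bar>s\<bar>)) \<longlonglongrightarrow> \<bar>s\<bar> * 1"
    by (intro tendsto_mult tendsto_const)
  then show ?thesis
    unfolding eq by simp
qed simp

text \<open>For t up to 1 the left side is at most t, which is at most t^p since p < 1; beyond that
  it is at most 1. This makes \<open>1 - exp (- u x)\<close> integrable.\<close>

lemma one_minus_exp_le_powr:
  fixes t :: real
  assumes "0 \<le> t" "0 < p" "p < 1"
  shows "1 - exp (- t) \<le> t powr p"
proof (cases "t \<le> 1")
  case True
  have "1 - exp (- t) \<le> t"
    using exp_ge_add_one_self[of "- t"] by simp
  also have "\<dots> \<le> t powr p"
    using assms True powr_mono'[of p 1 t] by (cases "t = 0") auto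
  finally show ?thesis .
next
  case False
  then have "1 \<le> t powr p"
    using assms by (intro ge_one_powr_ge_zero) auto
  then show ?thesis
    using exp_ge_zero[of "- t"] by linarith
qed

section \<open>Test functions and the distributions of continuous functions\<close>

lemma test_functionE:
  assumes "\<phi> \<in> test_functions \<Omega>"
  obtains K where "compact K" "K \<subseteq> \<Omega>" "\<And>x. x \<notin> K \<Longrightarrow> \<phi> x = 0" "\<And>k. Ck_on k \<phi> UNIV"
proof (rule that[of "closure {x. \<phi> x \<noteq> 0}"])
  show "\<phi> x = 0" if "x \<notin> closure {x. \<phi> x \<noteq> 0}" for x
    using that closure_subset[of "{x. \<phi> x \<noteq> 0}"] by blast
qed (use assms in \<open>simp_all add: test_functions_def smooth_on_def\<close>)

lemma test_functionI:
  assumes "\<And>k. Ck_on k \<phi> UNIV" "compact K" "K \<subseteq> \<Omega>" "\<And>x. x \<notin> K \<Longrightarrow> \<phi> x = 0"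
  shows "\<phi> \<in> test_functions \<Omega>"
proof -
  have "closure {x. \<phi> x \<noteq> 0} \<subseteq> K"
    using assms by (intro closure_minimal) (auto simp: compact_imp_closed)
  moreover have "bounded {x. \<phi> x \<noteq> 0}"
    by (rule bounded_subset[OF compact_imp_bounded[OF assms(2)]]) (use assms(4) in blast)
  ultimately show ?thesis
    using assms(1,3) by (auto simp: test_functions_def smooth_on_def)
qed

lemma integrable_test_function:
  assumes "\<phi> \<in> test_functions \<Omega>" "continuous_on UNIV w"
  shows "integrable lborel (\<lambda>x. w x * \<phi> x :: real)"
proof (rule test_functionE[OF assms(1)])
  fix K
  assume K: "compact K" "\<And>x. x \<notin> K \<Longrightarrow> \<phi> x = 0" and \<phi>: "\<And>k. Ck_on k \<phi> UNIV"
  show ?thesis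
    by (rule integrable_continuous_compact_support[OF continuous_on_mult[OF assms(2) Ck_continuous[OF \<phi>]] K(1)])
       (simp add: K(2))
qed

text \<open>A distribution of order 0: on a compact \<open>K\<close>, the estimate holds with the
  integral of |w| over \<open>K\<close> as constant and the sup norm as only seminorm.\<close>

lemma distribution_of_continuous:
  fixes w :: "real^'n \<Rightarrow> real"
  assumes w: "continuous_on UNIV w"
  shows "distribution_on \<Omega> (\<lambda>\<phi>. \<integral>x. w x * \<phi> x \<partial>lborel)"
  unfolding distribution_on_def
proof (intro conjI ballI allI impI)
  fix \<phi> \<psi> assume "\<phi> \<in> test_functions \<Omega>" "\<psi> \<in> test_functions \<Omega>"
  then show "(\<integral>x. w x * (\<phi> x + \<psi> x) \<partial>lborel) = (\<integral>x. w x * \<phi> x \<partial>lborel) + (\<integral>x. w x * \<psi> x \<partial>lborel)"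
    using w by (simp add: distrib_left integrable_test_function)
next
  fix c \<phi>
  show "(\<integral>x. w x * (c * \<phi> x) \<partial>lborel) = c * (\<integral>x. w x * \<phi> x \<partial>lborel)"
    by (simp add: mult.left_commute[of _ c])
next
  fix K :: "(real^'n) set"
  assume K: "compact K \<and> K \<subseteq> \<Omega>"
  define C where "C = (\<integral>x. indicator K x * \<bar>w x\<bar> \<partial>lborel)"
  have intK: "integrable lborel (\<lambda>x. indicator K x * \<bar>w x\<bar>)"
    using borel_integrable_compact[of K "\<lambda>x. \<bar>w x\<bar>"] K w
    by (auto intro!: continuous_intros continuous_on_subset[OF w])
  \<comment> \<open>For \<open>m = 0\<close> the only list of directions is the empty one, so the
    sum of seminorms is the sup norm of \<open>\<phi>\<close>.\<close>
  have lists: "{vs. set vs \<subseteq> (Basis :: (real^'n) set) \<and> length vs \<le> 0} = {[]}"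
    by auto
  have "\<bar>\<integral>x. w x * \<phi> x \<partial>lborel\<bar> \<le> C * (SUP x. \<bar>\<phi> x\<bar>)" if \<phi>: "\<phi> \<in> test_functions K" for \<phi>
  proof -
    obtain K' where K': "compact K'" "K' \<subseteq> K" "\<And>x. x \<notin> K' \<Longrightarrow> \<phi> x = 0" "\<And>k. Ck_on k \<phi> UNIV"
      by (rule test_functionE[OF \<phi>]) blast
    have "bounded (\<phi> ` K')"
      using K' by (intro compact_imp_bounded compact_continuous_image continuous_on_subset[OF Ck_continuous[OF K'(4)]]) auto
    then obtain M where M: "\<And>x. x \<in> K' \<Longrightarrow> \<bar>\<phi> x\<bar> \<le> M"
      by (auto simp: bounded_iff)
    have "\<bar>\<phi> x\<bar> \<le> max M 0" for x
      using M[of x] K'(3)[of x] by (cases "x \<in> K'") auto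
    \<comment> \<open>Boundedness matters because a real \<open>SUP\<close> is guaranteed to be an
      upper bound only for families that are bounded above.\<close>
    then have bdd: "bdd_above (range (\<lambda>x. \<bar>\<phi> x\<bar>))"
      by (auto intro!: bdd_aboveI2)
    have "\<bar>\<integral>x. w x * \<phi> x \<partial>lborel\<bar> \<le> (\<integral>x. \<bar>w x * \<phi> x\<bar> \<partial>lborel)"
      by (rule integral_abs_bound)
    also have "\<dots> \<le> (\<integral>x. indicator K x * \<bar>w x\<bar> * (SUP x. \<bar>\<phi> x\<bar>) \<partial>lborel)"
    proof (rule integral_mono)
      show "\<bar>w x * \<phi> x\<bar> \<le> indicator K x * \<bar>w x\<bar> * (SUP x. \<bar>\<phi> x\<bar>)" for x
      proof (cases "x \<in> K")
        case True
        then show ?thesis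
          using cSUP_upper[OF _ bdd, of x] by (simp add: abs_mult mult_left_mono)
      next
        case False
        then have "\<phi> x = 0" using K'(2,3) by blast
        then show ?thesis using False by simp
      qed
    qed (use intK integrable_test_function[OF \<phi> w] in auto)
    also have "\<dots> = C * (SUP x. \<bar>\<phi> x\<bar>)"
      by (simp add: C_def)
    finally show ?thesis .
  qed
  then show "\<exists>C m. \<forall>\<phi>\<in>test_functions K. \<bar>\<integral>x. w x * \<phi> x \<partial>lborel\<bar> \<le>
      C * (\<Sum>vs\<in>{vs. set vs \<subseteq> Basis \<and> length vs \<le> m}. SUP x. \<bar>foldr partial_derivative vs \<phi> x\<bar>)"
    by (intro exI[of _ C] exI[of _ 0] ballI, unfold lists) simp
qed

text \<open>Otherwise \<open>h\<close> keeps its sign on a ball around \<open>x\<close>, and a bump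
  function positive exactly there would give a nonzero integral.\<close>

lemma continuous_eq_0_by_test_functions:
  fixes h :: "real^'n \<Rightarrow> real"
  assumes h: "continuous_on UNIV h"
    and test: "\<And>\<phi>. \<phi> \<in> test_functions UNIV \<Longrightarrow> (\<integral>x. h x * \<phi> x \<partial>lborel) = 0"
  shows "h x = 0"
proof -
  \<comment> \<open>The factor \<open>s\<close> treats both signs of \<open>h x\<close> at once; it
    is instantiated with 1 and -1.\<close>
  have not_pos: "\<not> 0 < s * h x" for s
  proof
    assume pos: "0 < s * h x"
    have cont: "continuous_on UNIV (\<lambda>y. s * h y)"
      by (intro continuous_intros h)
    have "open {y. 0 < s * h y}"
      by (intro open_Collect_less continuous_on_const cont)
    then obtain r where r: "0 < r" "ball x r \<subseteq> {y. 0 < s * h y}"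
      using pos by (auto elim: openE)
    obtain \<phi> :: "real^'n \<Rightarrow> real" where \<phi>: "\<And>k. Ck_on k \<phi> UNIV" "\<And>x. 0 \<le> \<phi> x"
      "\<And>y. 0 < \<phi> y \<longleftrightarrow> y \<in> ball x r" "\<And>y. y \<notin> cball x r \<Longrightarrow> \<phi> y = 0"
      using exists_smooth_bump[OF r(1)] by blast
    have \<phi>_test: "\<phi> \<in> test_functions UNIV"
      using \<phi> by (intro test_functionI[of _ "cball x r"]) auto
    have nonneg: "0 \<le> (s * h y) * \<phi> y" for y
    proof (cases "y \<in> ball x r")
      case True
      then have "0 < s * h y" using r by blast
      then show ?thesis using \<phi>(2)[of y] by simp
    next
      case False
      then have "\<not> 0 < \<phi> y" using \<phi>(3)[of y] by blast
      then have "\<phi> y = 0" using \<phi>(2)[of y] by linarith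
      then show ?thesis by simp
    qed
    have int: "integrable lborel (\<lambda>y. (s * h y) * \<phi> y)"
      by (rule integrable_test_function[OF \<phi>_test cont])
    have "(\<integral>y. (s * h y) * \<phi> y \<partial>lborel) = 0"
      using test[OF \<phi>_test] by (simp add: mult.assoc)
    then have "AE y in lborel. (s * h y) * \<phi> y = 0"
      using integral_nonneg_eq_0_iff_AE[OF int] nonneg by simp
    then have "(s * h x) * \<phi> x = 0"
      by (intro continuous_AE_eq continuous_on_mult cont Ck_continuous[OF \<phi>(1)] continuous_on_const)
    then show False
      using pos \<phi>(3)[of x] r(1) by auto
  qed
  show ?thesis
    using not_pos[of 1] not_pos[of "- 1"] by simp
qed

section \<open>The Liouville theorem\<close>

text \<open>Both terms of the chain rule \<open>diff_op_compose\<close> vanish: one because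
  \<open>u\<close> is a solution, the other by the energy identity.\<close>

lemma diff_op_compose_eq_0:
  fixes A :: "real^'n \<Rightarrow> real^'n^'n" and u :: "real^'n \<Rightarrow> real"
  assumes A: "\<And>i j. Ck_on 1 (\<lambda>x. A x $ i $ j) UNIV"
    and b: "\<And>j. Ck_on 1 (\<lambda>x. b x $ j) UNIV"
    and u: "Ck_on 2 u UNIV" "\<And>x. diff_op A b u x = 0"
    and energy: "\<And>x. (A x *v gradient u x) \<bullet> gradient u x = 0"
    and h: "Ck_on 2 h UNIV"
  shows "diff_op A b (\<lambda>x. h (u x)) x = 0"
proof -
  have h': "Ck_on 1 (partial_derivative 1 h) UNIV"
    using h Ck_partial[of 1 h UNIV 1] by (simp only: Suc_1 Basis_real_def singletonI)
  have "diff_op A b (\<lambda>x. h (u x)) x = partial_derivative 1 h (u x) * diff_op A b u x +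
      partial_derivative 1 (partial_derivative 1 h) (u x) * ((A x *v gradient u x) \<bullet> gradient u x)"
    by (rule diff_op_compose[OF A b u(1) Ck_real_DERIV[OF h] Ck_real_DERIV[OF h']]) simp_all
  then show ?thesis
    by (simp add: u(2) energy)
qed

text \<open>The function |t - c| is not differentiable at \<open>c\<close>, so the chain rule is
  applied to the smooth functions \<open>h k\<close>, and the vanishing integrals pass to the limit
  by dominated convergence.\<close>

lemma integral_adjoint_op_abs_eq_0:
  fixes A :: "real^'n \<Rightarrow> real^'n^'n" and u :: "real^'n \<Rightarrow> real"
  assumes A: "\<And>i j. Ck_on 1 (\<lambda>x. A x $ i $ j) UNIV"
    and b: "\<And>j. Ck_on 1 (\<lambda>x. b x $ j) UNIV"
    and u: "Ck_on 2 u UNIV" "\<And>x. diff_op A b u x = 0"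
    and energy: "\<And>x. (A x *v gradient u x) \<bullet> gradient u x = 0"
    and \<phi>: "\<phi> \<in> test_functions \<Omega>"
  shows "(\<integral>x. adjoint_op A b \<phi> x * \<bar>u x - c\<bar> \<partial>lborel) = 0"
proof -
  obtain K where K: "compact K" "\<And>x. x \<notin> K \<Longrightarrow> \<phi> x = 0" and \<phi>k: "\<And>k. Ck_on k \<phi> UNIV"
    using test_functionE[OF \<phi>] by metis
  define h where "h k t = (t - c) * tanh (real k * (t - c))" for k :: nat and t
  have h: "Ck_on l (h k) UNIV" for k l
    unfolding h_def
    by (intro Ck_mult Ck_diff Ck_const Ck_compose[OF Ck_tanh] Ck_linear bounded_linear_ident)
  have hu: "Ck_on 2 (\<lambda>x. h k (u x)) UNIV" for k
    by (rule Ck_compose[OF h u(1)])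
  have zero: "(\<integral>x. adjoint_op A b \<phi> x * h k (u x) \<partial>lborel) = 0" for k
  proof -
    have "(\<integral>x. \<phi> x * diff_op A b (\<lambda>x. h k (u x)) x \<partial>lborel) = (\<integral>x. adjoint_op A b \<phi> x * h k (u x) \<partial>lborel)"
      by (rule integral_adjoint_op[OF A b \<phi>k hu K(1)]) (rule K(2))
    then show ?thesis
      by (simp add: diff_op_compose_eq_0[OF A b u energy h])
  qed
  have cont: "continuous_on UNIV (\<lambda>x. \<bar>u x - c\<bar>)"
    by (intro continuous_intros Ck_continuous[OF u(1)])
  have int: "integrable lborel (\<lambda>x. adjoint_op A b \<phi> x * \<bar>u x - c\<bar>)"
    by (rule integrable_adjoint_op[OF A b \<phi>k cont K(1)]) (rule K(2))
  have inth: "integrable lborel (\<lambda>x. adjoint_op A b \<phi> x * h k (u x))" for k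
    by (rule integrable_adjoint_op[OF A b \<phi>k Ck_continuous[OF hu] K(1)]) (rule K(2))
  have "(\<lambda>k. \<integral>x. adjoint_op A b \<phi> x * h k (u x) \<partial>lborel) \<longlonglongrightarrow>
      (\<integral>x. adjoint_op A b \<phi> x * \<bar>u x - c\<bar> \<partial>lborel)"
  proof (rule integral_dominated_convergence)
    show "integrable lborel (\<lambda>x. \<bar>adjoint_op A b \<phi> x * \<bar>u x - c\<bar>\<bar>)"
      using int by (rule integrable_abs)
    show "AE x in lborel. (\<lambda>k. adjoint_op A b \<phi> x * h k (u x)) \<longlonglongrightarrow> adjoint_op A b \<phi> x * \<bar>u x - c\<bar>"
      unfolding h_def by (intro AE_I2 tendsto_mult tendsto_const mult_tanh_tendsto_abs)
    show "AE x in lborel. norm (adjoint_op A b \<phi> x * h k (u x)) \<le> \<bar>adjoint_op A b \<phi> x * \<bar>u x - c\<bar>\<bar>" for k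
      unfolding h_def using abs_mult_tanh_le
      by (intro AE_I2) (simp add: abs_mult[of "adjoint_op A b \<phi> _"] mult_left_mono)
  qed (use int inth borel_measurable_integrable in auto)
  then have "(\<lambda>k. 0) \<longlonglongrightarrow> (\<integral>x. adjoint_op A b \<phi> x * \<bar>u x - c\<bar> \<partial>lborel)"
    by (simp only: zero)
  then show ?thesis
    by (rule LIMSEQ_unique) simp
qed

text \<open>In the weak form every derivative falls on the test function, so the functional can be
  identified with integration against \<open>adjoint_op\<close> without differentiating
  \<open>w\<close>.\<close>

lemma dist_diff_op_of_continuous:
  fixes A :: "real^'n \<Rightarrow> real^'n^'n"
  assumes A: "\<And>i j. Ck_on 1 (\<lambda>x. A x $ i $ j) UNIV"
    and b: "\<And>j. Ck_on 1 (\<lambda>x. b x $ j) UNIV"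
    and w: "continuous_on UNIV w" and \<phi>: "\<phi> \<in> test_functions \<Omega>"
  shows "dist_diff_op A b (\<lambda>\<phi>. \<integral>x. w x * \<phi> x \<partial>lborel) \<phi> = (\<integral>x. adjoint_op A b \<phi> x * w x \<partial>lborel)"
proof -
  obtain K where K: "compact K" "\<And>x. x \<notin> K \<Longrightarrow> \<phi> x = 0" and \<phi>k: "\<And>k. Ck_on k \<phi> UNIV"
    using test_functionE[OF \<phi>] by metis
  let ?d = "\<lambda>i. partial_derivative (axis i (1::real))"
  have K': "?d i \<phi> x = 0" if "x \<notin> K" for i x
    using partial_derivative_eq_0_outside[of K \<phi>, OF K(2) compact_imp_closed[OF K(1)]] that by blast
  have int: "integrable lborel (\<lambda>x. w x * ?d i g x)"
    if g: "Ck_on 1 g UNIV" "\<And>x. x \<notin> K \<Longrightarrow> g x = 0" for i g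
    by (rule integrable_continuous_compact_support[OF continuous_on_mult[OF w continuous_partial_C1[OF g(1)]] K(1)])
       (simp add: partial_derivative_eq_0_outside[OF g(2) compact_imp_closed[OF K(1)]])
  have int1: "integrable lborel (\<lambda>x. w x * ?d j (\<lambda>y. A y $ i $ j * ?d i \<phi> y) x)" for i j
    by (rule int[OF Ck_mult[OF A C1_partial[OF \<phi>k]]]) (simp add: K')
  have int2: "integrable lborel (\<lambda>x. w x * ?d i (\<lambda>y. b y $ i * \<phi> y) x)" for i
    by (rule int[OF Ck_mult[OF b \<phi>k]]) (simp add: K)
  \<comment> \<open>\<open>dist_partial\<close> contributes one minus sign per derivative: two
    cancel in the second-order term, one remains in the drift term.\<close>
  have "dist_diff_op A b (\<lambda>\<phi>. \<integral>x. w x * \<phi> x \<partial>lborel) \<phi> =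
      (\<Sum>i\<in>UNIV. \<Sum>j\<in>UNIV. \<integral>x. w x * ?d j (\<lambda>y. A y $ i $ j * ?d i \<phi> y) x \<partial>lborel) -
      (\<Sum>i\<in>UNIV. \<integral>x. w x * ?d i (\<lambda>y. b y $ i * \<phi> y) x \<partial>lborel)"
    by (simp add: dist_diff_op_def dist_partial_def dist_mult_def sum_negf)
  also have "\<dots> = (\<integral>x. (\<Sum>i\<in>UNIV. \<Sum>j\<in>UNIV. w x * ?d j (\<lambda>y. A y $ i $ j * ?d i \<phi> y) x) -
      (\<Sum>i\<in>UNIV. w x * ?d i (\<lambda>y. b y $ i * \<phi> y) x) \<partial>lborel)"
    using int1 int2
    by (subst Bochner_Integration.integral_diff)
       (simp_all only: Bochner_Integration.integral_sum Bochner_Integration.integrable_sum)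
  also have "\<dots> = (\<integral>x. adjoint_op A b \<phi> x * w x \<partial>lborel)"
    by (simp only: adjoint_op_def right_diff_distrib sum_distrib_left mult.commute[of _ "w _"])
  finally show ?thesis .
qed

text \<open>The function in the assumption is minimal at \<open>x\<close>, so its derivative there
  is 0; the remainder estimate that expresses this is, up to absolute values, the one for
  \<open>u\<close>.\<close>

lemma has_derivative_0_of_abs_differentiable:
  fixes u :: "'a::real_normed_vector \<Rightarrow> real"
  assumes "(\<lambda>y. \<bar>u y - u x\<bar>) differentiable (at x)"
  shows "(u has_derivative (\<lambda>_. 0)) (at x)"
proof -
  obtain D where D: "((\<lambda>y. \<bar>u y - u x\<bar>) has_derivative D) (at x)"
    using assms by (auto simp: differentiable_def)
  have "D = (\<lambda>_. 0)"
    using differential_zero_maxmin[OF _ open_UNIV D] by simp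
  then show ?thesis
    using D by (simp add: has_derivative_iff_norm)
qed

theorem theorem1p2:
  fixes A :: "real^'n \<Rightarrow> real^'n^'n"
    and b :: "real^'n \<Rightarrow> real^'n"
    and mul :: "real^'n \<Rightarrow> real^'n \<Rightarrow> real^'n"
    and e :: "real^'n"
    and iv :: "real^'n \<Rightarrow> real^'n"
    and p :: real
    and u :: "real^'n \<Rightarrow> real"
  assumes A_smooth: "\<And>i j. smooth_on (\<lambda>x. A x $ i $ j) UNIV"
    and b_smooth: "\<And>j. smooth_on (\<lambda>x. b x $ j) UNIV"
    and A_symmetric: "\<And>x. transpose (A x) = A x"
    and A_nonneg: "\<And>x \<xi>. (A x *v \<xi>) \<bullet> \<xi> \<ge> 0"
    and A_trace: "trace (A 0) > 0"
    and hypo: "hypoelliptic A b"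
    and lie: "lie_group mul e iv"
    and L_invariant: "left_translation_invariant mul (diff_op A b)"
    and leb_left: "lebesgue_left_invariant mul"
    and leb_right: "lebesgue_right_invariant mul"
    and p: "0 < p" "p < 1"
    and u_nonneg: "\<And>x. u x \<ge> 0"
    and u_Lp: "integrable lebesgue (\<lambda>x. u x powr p)"
    and u_smooth: "smooth_on u UNIV"
    and u_solution: "\<And>x. diff_op A b u x = 0"
  shows "\<forall>x. u x = 0"
proof -
  have A: "Ck_on k (\<lambda>x. A x $ i $ j) UNIV" and b: "Ck_on k (\<lambda>x. b x $ j) UNIV"
    and u: "Ck_on k u UNIV" for i j k
    using A_smooth b_smooth u_smooth by (simp_all add: smooth_on_def)
  have cont_u: "continuous_on UNIV u"
    by (rule Ck_continuous[OF u])
  then have [measurable]: "u \<in> borel_measurable borel"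
    by (rule borel_measurable_continuous_onI)
  \<comment> \<open>The integrand is Borel measurable, so integrability passes from the completed
    measure to \<open>lborel\<close>.\<close>
  have int_powr: "integrable lborel (\<lambda>x. u x powr p)"
    using u_Lp by (subst (asm) integrable_completion) simp_all

  define f where "f = (\<lambda>x. 1 - exp (- u x))"
  have "smooth_on f UNIV"
    unfolding smooth_on_def f_def by (intro allI Ck_diff Ck_const Ck_compose[OF Ck_exp_minus u])
  moreover have "integrable lborel f"
    by (rule Bochner_Integration.integrable_bound[OF int_powr])
       (use one_minus_exp_le_powr[OF u_nonneg p] u_nonneg in \<open>auto simp: f_def\<close>)
  moreover have Lf: "diff_op A b f x = - exp (- u x) * ((A x *v gradient u x) \<bullet> gradient u x)" for x
  proof -
    have "diff_op A b f x = exp (- u x) * diff_op A b u x +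
        - exp (- u x) * ((A x *v gradient u x) \<bullet> gradient u x)"
      unfolding f_def by (rule diff_op_compose[OF A b u]) (auto intro!: derivative_eq_intros)
    then show ?thesis by (simp add: u_solution)
  qed
  moreover have "diff_op A b f x \<le> 0" for x
    unfolding Lf using A_nonneg by (simp add: mult_nonneg_nonneg)
  ultimately have "diff_op A b f x = 0" for x
    using integrable_supersolution_imp_solution[OF A b lie L_invariant leb_right] by blast
  then have energy: "(A x *v gradient u x) \<bullet> gradient u x = 0" for x
    unfolding Lf by simp

  have "(u has_derivative (\<lambda>_. 0)) (at x)" for x
  proof -
    \<comment> \<open>The constant subtracted is the value of \<open>u\<close> at \<open>x\<close>,
      so that \<open>w\<close> attains its minimum there.\<close>
    define w where "w y = \<bar>u y - u x\<bar>" for y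
    let ?T = "\<lambda>\<phi>. \<integral>y. w y * \<phi> y \<partial>lborel"
    have w: "continuous_on UNIV w"
      unfolding w_def by (intro continuous_intros cont_u)
    have "dist_diff_op A b ?T \<phi> = 0" if "\<phi> \<in> test_functions UNIV" for \<phi>
      unfolding dist_diff_op_of_continuous[OF A b w that]
      unfolding w_def by (rule integral_adjoint_op_abs_eq_0[OF A b u u_solution energy that])
    \<comment> \<open>The zero function is the smooth representative.\<close>
    then have "smooth_distribution_on UNIV (dist_diff_op A b ?T)"
      unfolding smooth_distribution_on_def smooth_on_def
      by (intro exI[of _ "\<lambda>_. 0"]) (simp add: Ck_const)
    then have "smooth_distribution_on UNIV ?T"
      using hypo distribution_of_continuous[OF w] unfolding hypoelliptic_def by blast
    then obtain g where g: "smooth_on g UNIV"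
      "\<And>\<phi>. \<phi> \<in> test_functions UNIV \<Longrightarrow> ?T \<phi> = (\<integral>y. g y * \<phi> y \<partial>lebesgue)"
      unfolding smooth_distribution_on_def by blast
    have cont_g: "continuous_on UNIV g"
      by (rule Ck_continuous[OF smooth_imp_Ck[OF g(1)]])
    \<comment> \<open>\<open>g\<close> represents the same distribution as \<open>w\<close>. Both
      are continuous, so they agree at every point and \<open>w\<close> itself is
      differentiable.\<close>
    have "w y - g y = 0" for y
    proof (rule continuous_eq_0_by_test_functions)
      fix \<phi> :: "real^'n \<Rightarrow> real"
      assume \<phi>: "\<phi> \<in> test_functions UNIV"
      note int = integrable_test_function[OF \<phi> w] integrable_test_function[OF \<phi> cont_g]
      have "?T \<phi> = (\<integral>y. g y * \<phi> y \<partial>lborel)"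
        using g(2)[OF \<phi>] integral_completion[OF borel_measurable_integrable[OF int(2)]] by simp
      then show "(\<integral>y. (w y - g y) * \<phi> y \<partial>lborel) = 0"
        using int by (simp add: left_diff_distrib)
    qed (intro continuous_intros w cont_g)
    then have "w = g"
      by auto
    then have "w differentiable (at x)"
      using Ck_has_derivative[OF smooth_imp_Ck[OF g(1)], of 1] by (auto simp: differentiable_def)
    then show ?thesis
      unfolding w_def by (rule has_derivative_0_of_abs_differentiable)
  qed
  then obtain c where c: "\<And>x. u x = c"
    using has_derivative_zero_constant[of UNIV u] by auto
  \<comment> \<open>The whole space has infinite measure, so an integrable constant is 0; and
    \<open>c powr p = 0\<close> forces \<open>c = 0\<close>.\<close>
  have "c powr p = 0"
    using int_powr by (auto simp: c integrable_iff_bounded ennreal_mult_less_top)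
  then show ?thesis
    by (simp add: c)
qed

end
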